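(* Let $1<\alpha<2$. Let $d_+,d_-$ be nonnegative functions on $[x_L,x_R]$ with $d_+>0$, put $\tilde d(x)=d_-(x)/d_+(x)$, and suppose that $0\le\kappa_{min}\le\tilde d(x)\le\kappa_{max}<\infty$ on $[x_L,x_R]$ for constants $\kappa_{min},\kappa_{max}$, and that $\tilde d$ is concave or convex on $[x_L,x_R]$. Let $\kappa=\kappa_{max}$ when $\tilde d$ is concave, and $\kappa=\kappa_{min}$ when $\tilde d$ is convex. Suppose $$1+\kappa-\frac{\sqrt{2}\,(\kappa_{max}-\kappa_{min})}{\varsigma_\alpha}\ge 0.$$ Then the finite difference scheme $$(I-\nu_{\tau,h,\alpha}A)u^{n+1}=(I+\nu_{\tau,h,\alpha}A)u^{n}+\tau f^{n+\frac12},\quad n=0,1,\dots,N-1,\qquad u^0=\varphi,$$ is stable: its solutions satisfy $$\|u^{n+1}\|_{\hat D}^2\le e^{2T}\Big(\|\varphi\|_{\hat D}^2+2T\max_{0\le k\le n}\|f^{k+\frac12}\|_{\hat D}^2\Big),\quad n=0,1,\dots,N-1,$$ where $\|v\|_{\hat D}^2=h\,v^T\hat D v$ with $\hat D=D_+^{-1}$.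
   Context: $M,N$ are positive integers, $T>0$, $h=(x_R-x_L)/M$, $\tau=T/N$, $x_i=x_L+ih$, $t_n=n\tau$, $t_{n+\frac12}=\frac12(t_n+t_{n+1})$. The scheme discretizes the fractional diffusion equation $\partial_t u=d_+(x)\,{}_{x_L}D_x^{\alpha}u+d_-(x)\,{}_xD_{x_R}^{\alpha}u+f(x,t)$ on $(x_L,x_R)\times(0,T]$ (left and right Riemann–Liouville derivatives in $x$) with zero boundary values and initial value $\varphi(x)$. Here $u^n=[u_1^n,\dots,u_{M-1}^n]^T$, $f^{n+\frac12}=[f(x_1,t_{n+\frac12}),\dots,f(x_{M-1},t_{n+\frac12})]^T$, $\varphi=[\varphi(x_1),\dots,\varphi(x_{M-1})]^T$, $\nu_{\tau,h,\alpha}=\frac{\tau}{2h^\alpha}$, $I$ is the identity matrix, $D_\pm=\mathrm{diag}(d_\pm(x_1),\dots,d_\pm(x_{M-1}))$, and $A=D_+W_\alpha+D_-W_\alpha^T$. Define $g_0^{(\alpha)}=1$, $g_k^{(\alpha)}=\big(1-\frac{\alpha+1}{k}\big)g_{k-1}^{(\alpha)}$ for $k\ge 1$, and $$w_0^{(\alpha)}=\frac{\alpha}{2}g_0^{(\alpha)},\qquad w_k^{(\alpha)}=\frac{\alpha}{2}g_k^{(\alpha)}+\frac{2-\alpha}{2}g_{k-1}^{(\alpha)}\quad (k\ge 1).$$ $W_\alpha$ is the $(M-1)\times(M-1)$ Toeplitz matrix with entries $(W_\alpha)_{ij}=w_{i-j+1}^{(\alpha)}$ if $i-j+1\ge 0$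 and $0$ otherwise. With $g(\alpha,x)=\sum_{k=0}^{\infty}w_k^{(\alpha)}e^{\mathbf{i}(k-1)x}$, $$\varsigma_\alpha=\inf_{x\in[-\pi,\pi]\setminus\{0\}}\frac{\Re[-g(\alpha,x)]}{|g(\alpha,x)|}=\Big|\cos\Big(\frac{\alpha}{2}\pi\Big)\Big|.$$ If $\tilde d$ is both concave and convex (affine), either choice of $\kappa$ is allowed. *)

theory Defs
  imports
    "HOL-Analysis.Analysis"
    "Jordan_Normal_Form.Matrix"
    "Jordan_Normal_Form.Gauss_Jordan_Elimination"
begin

text \<open>Matrices and vectors of size \<open>M - 1\<close> are those of \<open>Jordan_Normal_Form.Matrix\<close>.  They are
  indexed from 0, so index \<open>i\<close> here belongs to the interior grid point \<open>x_{i+1}\<close>.\<close>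

primrec grunwald_g :: "real \<Rightarrow> nat \<Rightarrow> real" where
  "grunwald_g \<alpha> 0 = 1"
| "grunwald_g \<alpha> (Suc k) = (1 - (\<alpha> + 1) / real (Suc k)) * grunwald_g \<alpha> k"

fun wsgd_w :: "real \<Rightarrow> nat \<Rightarrow> real" where
  "wsgd_w \<alpha> 0 = \<alpha> / 2 * grunwald_g \<alpha> 0"
| "wsgd_w \<alpha> (Suc k) = \<alpha> / 2 * grunwald_g \<alpha> (Suc k) + (2 - \<alpha>) / 2 * grunwald_g \<alpha> k"

text \<open>The condition \<open>j \<le> i + 1\<close> is \<open>i - j + 1 \<ge> 0\<close> without truncated subtraction.\<close>

definition wsgd_W :: "real \<Rightarrow> nat \<Rightarrow> real mat" where
  "wsgd_W \<alpha> M = Matrix.mat (M - 1) (M - 1)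
     (\<lambda>(i, j). if j \<le> i + 1 then wsgd_w \<alpha> (i + 1 - j) else 0)"

definition gen_g :: "real \<Rightarrow> real \<Rightarrow> complex" where
  "gen_g \<alpha> x = (\<Sum>k. complex_of_real (wsgd_w \<alpha> k) * exp (\<i> * complex_of_real ((real k - 1) * x)))"

text \<open>For \<open>1 < \<alpha> < 2\<close> the infimum equals \<open>\<bar>cos (\<alpha> * pi / 2)\<bar>\<close>.\<close>

definition varsigma :: "real \<Rightarrow> real" where
  "varsigma \<alpha> = (INF x\<in>{-pi..pi} - {0}. Re (- gen_g \<alpha> x) / cmod (gen_g \<alpha> x))"

definition mesh_h :: "real \<Rightarrow> real \<Rightarrow> nat \<Rightarrow> real" where
  "mesh_h xL xR M = (xR - xL) / real M"

definition grid_x :: "real \<Rightarrow> real \<Rightarrow> nat \<Rightarrow> nat \<Rightarrow> real" where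
  "grid_x xL xR M i = xL + real i * mesh_h xL xR M"

definition mesh_tau :: "real \<Rightarrow> nat \<Rightarrow> real" where
  "mesh_tau T N = T / real N"

definition time_t :: "real \<Rightarrow> nat \<Rightarrow> nat \<Rightarrow> real" where
  "time_t T N n = real n * mesh_tau T N"

definition time_half :: "real \<Rightarrow> nat \<Rightarrow> nat \<Rightarrow> real" where
  "time_half T N n = 1 / 2 * (time_t T N n + time_t T N (n + 1))"

definition scheme_nu :: "real \<Rightarrow> real \<Rightarrow> real \<Rightarrow> real" where
  "scheme_nu \<tau> h \<alpha> = \<tau> / (2 * h powr \<alpha>)"

definition grid_vec :: "real \<Rightarrow> real \<Rightarrow> nat \<Rightarrow> (real \<Rightarrow> real) \<Rightarrow> real vec" where
  "grid_vec xL xR M \<phi> = Matrix.vec (M - 1) (\<lambda>i. \<phi> (grid_x xL xR M (i + 1)))"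

definition source_vec ::
  "real \<Rightarrow> real \<Rightarrow> nat \<Rightarrow> real \<Rightarrow> nat \<Rightarrow> (real \<Rightarrow> real \<Rightarrow> real) \<Rightarrow> nat \<Rightarrow> real vec" where
  "source_vec xL xR M T N f n = grid_vec xL xR M (\<lambda>x. f x (time_half T N n))"

definition diag_D :: "real \<Rightarrow> real \<Rightarrow> nat \<Rightarrow> (real \<Rightarrow> real) \<Rightarrow> real mat" where
  "diag_D xL xR M d = mat_diag (M - 1) (\<lambda>i. d (grid_x xL xR M (i + 1)))"

definition scheme_A ::
  "real \<Rightarrow> real \<Rightarrow> nat \<Rightarrow> real \<Rightarrow> (real \<Rightarrow> real) \<Rightarrow> (real \<Rightarrow> real) \<Rightarrow> real mat" where
  "scheme_A xL xR M \<alpha> dp dm =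
     diag_D xL xR M dp * wsgd_W \<alpha> M + diag_D xL xR M dm * transpose_mat (wsgd_W \<alpha> M)"

text \<open>\<open>the\<close> is harmless here: \<open>D_+\<close> is invertible as soon as \<open>d_+\<close> has no zero at the
  interior grid points, see \<open>Dhat_eq\<close> below.\<close>

definition Dhat :: "real \<Rightarrow> real \<Rightarrow> nat \<Rightarrow> (real \<Rightarrow> real) \<Rightarrow> real mat" where
  "Dhat xL xR M dp = the (mat_inverse (diag_D xL xR M dp))"

lemma Dhat_eq:
  assumes "\<And>i. i < M - 1 \<Longrightarrow> dp (grid_x xL xR M (i + 1)) \<noteq> 0"
  shows "Dhat xL xR M dp = diag_D xL xR M (\<lambda>x. 1 / dp x)"
proof -
  let ?n = "M - 1"
  let ?D = "diag_D xL xR M dp"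
  let ?E = "diag_D xL xR M (\<lambda>x. 1 / dp x)"
  have D: "?D \<in> carrier_mat ?n ?n" and E: "?E \<in> carrier_mat ?n ?n"
    by (simp_all add: diag_D_def)
  have DE: "?D * ?E = 1\<^sub>m ?n" and ED: "?E * ?D = 1\<^sub>m ?n"
    using assms by (auto simp: diag_D_def, auto simp: mat_diag_def)
  have "?D \<in> Units (ring_mat TYPE(real) ?n ())"
    using D E DE ED by (auto simp: Units_def ring_mat_def)
  then obtain B where B: "mat_inverse ?D = Some B"
    using mat_inverse(1)[OF D, where b = "()"] by (cases "mat_inverse ?D") auto
  from mat_inverse(2)[OF D B] have BD: "B * ?D = 1\<^sub>m ?n" and Bc: "B \<in> carrier_mat ?n ?n"
    by auto
  have "B = B * (?D * ?E)" using Bc DE by simp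
  also have "\<dots> = (B * ?D) * ?E" using assoc_mult_mat[OF Bc D E] by simp
  also have "\<dots> = ?E" using BD E by simp
  finally show ?thesis using B by (simp add: Dhat_def)
qed

text \<open>The squared norm \<open>\<parallel>v\<parallel>\<^sup>2 = h * (v\<^sup>T G v)\<close> of a weight matrix \<open>G\<close>.\<close>

definition wnorm2 :: "real \<Rightarrow> real mat \<Rightarrow> real vec \<Rightarrow> real" where
  "wnorm2 h G v = h * scalar_prod v (G *\<^sub>v v)"

definition solves_scheme ::
  "real \<Rightarrow> real \<Rightarrow> nat \<Rightarrow> real \<Rightarrow> nat \<Rightarrow> real \<Rightarrow> (real \<Rightarrow> real) \<Rightarrow> (real \<Rightarrow> real) \<Rightarrow>
   (real \<Rightarrow> real \<Rightarrow> real) \<Rightarrow> (real \<Rightarrow> real) \<Rightarrow> (nat \<Rightarrow> real vec) \<Rightarrow> bool" where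
  "solves_scheme xL xR M T N \<alpha> dp dm f \<phi> u \<longleftrightarrow>
     (let \<tau> = mesh_tau T N;
          \<nu> = scheme_nu \<tau> (mesh_h xL xR M) \<alpha>;
          A = scheme_A xL xR M \<alpha> dp dm
      in (\<forall>n\<le>N. u n \<in> carrier_vec (M - 1)) \<and>
         u 0 = grid_vec xL xR M \<phi> \<and>
         (\<forall>n<N. (1\<^sub>m (M - 1) - \<nu> \<cdot>\<^sub>m A) *\<^sub>v u (n + 1) =
                (1\<^sub>m (M - 1) + \<nu> \<cdot>\<^sub>m A) *\<^sub>v u n + \<tau> \<cdot>\<^sub>v source_vec xL xR M T N f n))"

end

theory Submission
  imports Defs
begin

text \<open>
  Dividing row \<open>i\<close> of the scheme by \<open>d\<^sub>+(x\<^sub>i)\<close> turns \<open>A\<close> into \<open>W + DW\<^sup>T\<close>, where \<open>D\<close> is the diagonal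
  matrix of the values of \<open>d\<^sub>- / d\<^sub>+\<close>.  Testing the divided scheme with \<open>u\<^sup>n\<^sup>+\<^sup>1 + u\<^sup>n\<close> gives the difference of
  the two squared norms on the left, and on the right the quadratic form of \<open>W + DW\<^sup>T\<close> plus a source
  term.  So stability follows once \<open>v\<^sup>T(W + DW\<^sup>T)v \<le> 0\<close> for all \<open>v\<close>.

  For this inequality write \<open>E(v) = - v\<^sup>TWv\<close> for the energy of \<open>v\<close>, which is nonnegative, and
  \<open>D = \<kappa> + s diag(e)\<close>, where \<open>s\<close> is a sign and \<open>e\<close> is a convex sequence with values in \<open>[0, K]\<close>,
  \<open>K = \<kappa>max - \<kappa>min\<close>.  Then \<open>v\<^sup>T(W + DW\<^sup>T)v = - (1 + \<kappa>) E(v) + s v\<^sup>TW(ev)\<close>, and the last term is at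
  most \<open>\<surd>2 K E(v) / \<varsigma>\<close> for two reasons.

  \<^item> The generating function takes its values in a sector, \<open>\<varsigma> |g| \<le> Re (-g)\<close>.  Writing \<open>a\<^sup>TWb\<close> as the
    integral of \<open>g\<close> against the trigonometric polynomials of \<open>a\<close> and \<open>b\<close> turns this into
    \<open>2 \<varsigma> a\<^sup>TWb \<le> t E(a) + E(b) / t\<close> for every \<open>t > 0\<close> (\<open>wsgd_form_sector_bound\<close>).
  \<^item> Multiplication by \<open>e\<close> is bounded in energy, \<open>E(ev) \<le> 2 K\<^sup>2 E(v)\<close>
    (\<open>wsgd_form_diag_convex_multiplier\<close>).  The signs of the weights make \<open>E\<close> a nonnegative combination
    of sums of squared differences over a fixed lag, and for each of these sums convexity of \<open>e\<close>
    controls the terms in which \<open>e\<close> itself is differenced.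

  The hypothesis on \<open>\<kappa>\<close> is then exactly what makes the form nonpositive.  It carries information
  only because \<open>\<varsigma>\<close> is positive (\<open>varsigma_pos\<close>); this is a compactness argument on the closed form
  of \<open>g\<close>, whose argument has a limit strictly inside the left half plane as \<open>x\<close> decreases to \<open>0\<close>.

  In time, the norm itself, instead of its square, grows by at most \<open>\<tau>\<close> times the norm of the source
  in one step (\<open>scheme_step_bound\<close>), whatever the size of \<open>\<tau>\<close>.  Summing the steps and squaring at the
  end gives the bound (\<open>square_growth_bound\<close>).
\<close>

section \<open>The Grunwald coefficients and their weighted shifts\<close>

text \<open>Since \<open>g\<^sub>k\<close> is \<open>(-1)\<^sup>k\<close> times the binomial coefficient of \<open>\<alpha>\<close> over \<open>k\<close>, this is the absorption
  identity.  It reduces signs and partial sums for \<open>\<alpha>\<close> to the coefficients for \<open>\<alpha> - 1\<close>, an exponent in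
  \<open>(0, 1)\<close>, for which every factor of the recursion after the first is positive.\<close>
lemma grunwald_g_shift:
  "real (Suc n) * grunwald_g \<alpha> (Suc n) = - \<alpha> * grunwald_g (\<alpha> - 1) n"
proof (induction n)
  case (Suc n)
  have "real (Suc (Suc n)) * grunwald_g \<alpha> (Suc (Suc n))
      = (real (Suc n) - \<alpha>) * grunwald_g \<alpha> (Suc n)"
    by (simp add: field_simps del: grunwald_g.simps(2) add: grunwald_g.simps(2)[of \<alpha> "Suc n"])
  also have "\<dots> = (1 - \<alpha> / real (Suc n)) * (real (Suc n) * grunwald_g \<alpha> (Suc n))"
    by (simp add: field_simps del: grunwald_g.simps)
  also have "\<dots> = - \<alpha> * grunwald_g (\<alpha> - 1) (Suc n)"
    by (simp only: Suc.IH) simp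
  finally show ?case .
qed simp

lemma sum_grunwald_g: "(\<Sum>k\<le>n. grunwald_g \<alpha> k) = grunwald_g (\<alpha> - 1) n"
proof (induction n)
  case (Suc n)
  have "grunwald_g \<alpha> (Suc n) = - \<alpha> / real (Suc n) * grunwald_g (\<alpha> - 1) n"
    using grunwald_g_shift[of n \<alpha>] by (simp add: field_simps del: grunwald_g.simps)
  then show ?case using Suc.IH by (simp add: algebra_simps del: grunwald_g.simps(2) add: grunwald_g.simps(2)[of "\<alpha> - 1"])
qed simp

lemma grunwald_g_neg:
  assumes "0 < \<beta>" "\<beta> < 1"
  shows "grunwald_g \<beta> (Suc n) < 0"
proof (induction n)
  case 0 then show ?case using assms by simp
next
  case (Suc n)
  have "1 - (\<beta> + 1) / real (Suc (Suc n)) > 0" using assms by simp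
  then show ?case unfolding grunwald_g.simps(2)[of \<beta> "Suc n"] using Suc.IH by (rule mult_pos_neg)
qed

lemma grunwald_g_nonneg:
  assumes "1 < \<alpha>" "\<alpha> < 2"
  shows "grunwald_g \<alpha> (Suc (Suc n)) \<ge> 0"
proof -
  have "\<alpha> * grunwald_g (\<alpha> - 1) (Suc n) \<le> 0"
    using grunwald_g_neg[of "\<alpha> - 1" n] assms by (intro mult_nonneg_nonpos) auto
  then have "real (Suc (Suc n)) * grunwald_g \<alpha> (Suc (Suc n)) \<ge> 0"
    using grunwald_g_shift[of "Suc n" \<alpha>] by (simp del: grunwald_g.simps)
  then show ?thesis by (simp add: zero_le_mult_iff del: grunwald_g.simps)
qed

text \<open>All coefficients from index 2 on are nonnegative, so bounded partial sums suffice, and these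
  telescope into a single coefficient of the exponent \<open>\<alpha> - 1\<close>.\<close>
lemma summable_norm_grunwald_g:
  assumes "1 < \<alpha>" "\<alpha> < 2"
  shows "summable (\<lambda>k. \<bar>grunwald_g \<alpha> k\<bar>)"
proof -
  have "summable (\<lambda>k. \<bar>grunwald_g \<alpha> (k + 2)\<bar>)"
  proof (rule summableI_nonneg_bounded)
    fix n
    have "(\<Sum>k<n. \<bar>grunwald_g \<alpha> (k + 2)\<bar>) = (\<Sum>k<n. grunwald_g \<alpha> (k + 2))"
      using grunwald_g_nonneg[OF assms] by (intro sum.cong) (auto simp del: grunwald_g.simps)
    also have "\<dots> = (\<Sum>k<n + 2. grunwald_g \<alpha> k) - (1 - \<alpha>)"
      by (induction n) (auto simp: numeral_2_eq_2)
    also have "(\<Sum>k<n + 2. grunwald_g \<alpha> k) = grunwald_g (\<alpha> - 1) (Suc n)"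
      using sum_grunwald_g[of \<alpha> "Suc n"] by (simp add: lessThan_Suc_atMost del: grunwald_g.simps)
    finally show "(\<Sum>k<n. \<bar>grunwald_g \<alpha> (k + 2)\<bar>) \<le> \<alpha> - 1"
      using grunwald_g_neg[of "\<alpha> - 1" n] assms by simp
  qed auto
  then show ?thesis by (subst (asm) summable_iff_shift)
qed

lemma summable_norm_wsgd_w:
  assumes "1 < \<alpha>" "\<alpha> < 2"
  shows "summable (\<lambda>k. \<bar>wsgd_w \<alpha> k\<bar>)"
proof -
  have s: "summable (\<lambda>k. \<bar>grunwald_g \<alpha> k\<bar>)" by (rule summable_norm_grunwald_g[OF assms])
  have "summable (\<lambda>k. \<alpha> / 2 * \<bar>grunwald_g \<alpha> (Suc k)\<bar> + (2 - \<alpha>) / 2 * \<bar>grunwald_g \<alpha> k\<bar>)"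
    by (intro summable_add summable_mult s s[THEN summable_Suc_iff[THEN iffD2]])
  then have "summable (\<lambda>k. \<bar>wsgd_w \<alpha> (Suc k)\<bar>)"
  proof (rule summable_comparison_test')
    show "norm \<bar>wsgd_w \<alpha> (Suc k)\<bar> \<le> \<alpha> / 2 * \<bar>grunwald_g \<alpha> (Suc k)\<bar> + (2 - \<alpha>) / 2 * \<bar>grunwald_g \<alpha> k\<bar>" for k
      using assms by (auto simp: abs_mult intro: order.trans[OF abs_triangle_ineq] simp del: grunwald_g.simps)
  qed
  then show ?thesis by (subst (asm) summable_Suc_iff)
qed

lemma wsgd_w_0_2:
  "wsgd_w \<alpha> 0 + wsgd_w \<alpha> 2 = \<alpha> * (\<alpha> - 1) * (\<alpha> + 2) / 4"
  by (simp add: numeral_2_eq_2 field_simps)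

lemma wsgd_w_0_2_pos: "1 < \<alpha> \<Longrightarrow> wsgd_w \<alpha> 0 + wsgd_w \<alpha> 2 > 0"
  unfolding wsgd_w_0_2 by simp

lemma wsgd_w_nonneg:
  assumes "1 < \<alpha>" "\<alpha> < 2"
  shows "wsgd_w \<alpha> (k + 3) \<ge> 0"
  using grunwald_g_nonneg[OF assms, of k] grunwald_g_nonneg[OF assms, of "Suc k"] assms
  by (auto simp: numeral_3_eq_3 simp del: grunwald_g.simps)

text \<open>At least three terms have to be summed: \<open>w\<^sub>0 + w\<^sub>1 = 1 - \<alpha>\<^sup>2 / 2\<close> is positive for
  \<open>\<alpha> < \<surd>2\<close>.\<close>
lemma sum_wsgd_w_nonpos:
  assumes "1 < \<alpha>" "\<alpha> < 2"
  shows "(\<Sum>k\<le>n + 2. wsgd_w \<alpha> k) \<le> 0"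
proof -
  have "(\<Sum>k\<le>Suc m. wsgd_w \<alpha> k)
      = \<alpha> / 2 * (\<Sum>k\<le>Suc m. grunwald_g \<alpha> k) + (2 - \<alpha>) / 2 * (\<Sum>k\<le>m. grunwald_g \<alpha> k)" for m
    by (induction m) (simp_all add: algebra_simps del: grunwald_g.simps)
  from this[of "Suc n"] have "(\<Sum>k\<le>n + 2. wsgd_w \<alpha> k)
      = \<alpha> / 2 * grunwald_g (\<alpha> - 1) (Suc (Suc n)) + (2 - \<alpha>) / 2 * grunwald_g (\<alpha> - 1) (Suc n)"
    unfolding sum_grunwald_g by simp
  also have "\<dots> \<le> 0"
    using grunwald_g_neg[of "\<alpha> - 1" n] grunwald_g_neg[of "\<alpha> - 1" "Suc n"] assms
    by (intro add_nonpos_nonpos mult_nonneg_nonpos) (auto simp del: grunwald_g.simps)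
  finally show ?thesis .
qed

section \<open>Lagged products and convex multipliers\<close>

text \<open>The autocorrelation of \<open>v\<close> at lag \<open>m\<close>.  With \<open>v\<close> extended by zero,
  \<open>lag_sum n 0 v - lag_sum n m v\<close> is half the sum of the squares \<open>(v\<^sub>i\<^sub>+\<^sub>m - v\<^sub>i)\<^sup>2\<close>.\<close>
definition lag_sum :: "nat \<Rightarrow> nat \<Rightarrow> (nat \<Rightarrow> real) \<Rightarrow> real" where
  "lag_sum n m v = (\<Sum>i<n - m. v i * v (i + m))"

text \<open>A discrete version of \<open>\<integral>((ev)')\<^sup>2 = \<integral>e\<^sup>2 v'\<^sup>2 - \<integral>e e'' v\<^sup>2\<close>, where convexity makes the last term
  harmless.  Every cross product \<open>v\<^sub>i v\<^sub>i\<^sub>+\<^sub>m\<close> enters the difference of the two sides with the nonnegative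
  weight \<open>2 K\<^sup>2 - e\<^sub>i e\<^sub>i\<^sub>+\<^sub>m\<close> and is estimated by the squares, which leaves a diagonal form.  Its
  coefficient at an index with both neighbours at distance \<open>m\<close> is \<open>e\<^sub>i\<close> times the second difference
  of \<open>e\<close>.  At an index that lacks a neighbour it is at least \<open>2 K\<^sup>2 - 2 e\<^sub>i\<^sup>2\<close>, and this is where the
  factor 2 enters, because \<open>e\<close> may drop from \<open>K\<close> to \<open>0\<close> within \<open>m\<close> steps of the boundary.\<close>
lemma lag_form_convex_multiplier:
  fixes e v :: "nat \<Rightarrow> real"
  assumes K: "\<And>i. i < n \<Longrightarrow> 0 \<le> e i \<and> e i \<le> K"
    and conv: "\<And>i k. k \<le> i \<Longrightarrow> i + k < n \<Longrightarrow> 2 * e i \<le> e (i - k) + e (i + k)"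
  shows "lag_sum n 0 (\<lambda>i. e i * v i) - lag_sum n m (\<lambda>i. e i * v i)
    \<le> 2 * K\<^sup>2 * (lag_sum n 0 v - lag_sum n m v)"
proof -
  let ?r = "\<lambda>i. if i + m < n then 2 * K\<^sup>2 - e i * e (i + m) else 0"
  let ?l = "\<lambda>i. if m \<le> i then 2 * K\<^sup>2 - e i * e (i - m) else 0"
  have ee: "0 \<le> e i * e j" "e i * e j \<le> K\<^sup>2" if "i < n" "j < n" for i j
    using K[OF that(1)] K[OF that(2)] by (auto simp: power2_eq_square intro!: mult_mono)
  \<comment> \<open>\<open>?r i\<close> and \<open>?l i\<close> collect what \<open>v\<^sub>i\<^sup>2\<close> receives from the pair with its right and left neighbour.\<close>
  have bracket: "?r i + ?l i \<le> 2 * (2 * K\<^sup>2 - (e i)\<^sup>2)" if i: "i < n" for i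
  proof -
    have "i + m < n \<Longrightarrow> m \<le> i \<Longrightarrow> e i * (2 * e i) \<le> e i * (e (i - m) + e (i + m))"
      using conv[of m i] K[OF i] by (intro mult_left_mono) auto
    moreover have "i - m < n" using i by simp
    ultimately show ?thesis
      using ee[OF i i] ee[OF i, of "i + m"] ee[OF i, of "i - m"] i
      by (auto simp: power2_eq_square algebra_simps split: if_splits)
  qed
  have "2 * (\<Sum>i<n - m. (2 * K\<^sup>2 - e i * e (i + m)) * (v i * v (i + m)))
      \<le> (\<Sum>i<n - m. (2 * K\<^sup>2 - e i * e (i + m)) * ((v i)\<^sup>2 + (v (i + m))\<^sup>2))"
    unfolding sum_distrib_left
  proof (rule sum_mono)
    fix i assume i: "i \<in> {..<n - m}"
    have "2 * K\<^sup>2 - e i * e (i + m) \<ge> 0" using ee[of i "i + m"] i by (auto simp: less_diff_conv)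
    moreover have "2 * (v i * v (i + m)) \<le> (v i)\<^sup>2 + (v (i + m))\<^sup>2"
      using sum_squares_bound[of "v i" "v (i + m)"] by (simp add: mult.assoc)
    ultimately have "(2 * K\<^sup>2 - e i * e (i + m)) * (2 * (v i * v (i + m)))
      \<le> (2 * K\<^sup>2 - e i * e (i + m)) * ((v i)\<^sup>2 + (v (i + m))\<^sup>2)"
      by (intro mult_left_mono)
    then show "2 * ((2 * K\<^sup>2 - e i * e (i + m)) * (v i * v (i + m)))
      \<le> (2 * K\<^sup>2 - e i * e (i + m)) * ((v i)\<^sup>2 + (v (i + m))\<^sup>2)"
      by (simp only: mult.assoc mult.left_commute)
  qed
  also have "\<dots> = (\<Sum>i<n. ?r i * (v i)\<^sup>2) + (\<Sum>i<n. ?l i * (v i)\<^sup>2)"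
  proof -
    have "(\<Sum>i<n - m. (2 * K\<^sup>2 - e i * e (i + m)) * (v i)\<^sup>2) = (\<Sum>i<n. ?r i * (v i)\<^sup>2)"
      by (intro sum.mono_neutral_cong_left) auto
    moreover have "(\<Sum>i<n - m. (2 * K\<^sup>2 - e i * e (i + m)) * (v (i + m))\<^sup>2)
        = (\<Sum>i\<in>{m..<n}. (2 * K\<^sup>2 - e i * e (i - m)) * (v i)\<^sup>2)"
      by (rule sum.reindex_bij_witness[of _ "\<lambda>i. i - m" "\<lambda>i. i + m"]) (auto simp: mult.commute)
    moreover have "\<dots> = (\<Sum>i<n. ?l i * (v i)\<^sup>2)"
      by (intro sum.mono_neutral_cong_left) auto
    ultimately show ?thesis by (simp only: distrib_left sum.distrib)
  qed
  also have "\<dots> = (\<Sum>i<n. (?r i + ?l i) * (v i)\<^sup>2)"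
    by (simp only: sum.distrib[symmetric] distrib_right)
  also have "\<dots> \<le> (\<Sum>i<n. 2 * (2 * K\<^sup>2 - (e i)\<^sup>2) * (v i)\<^sup>2)"
    using bracket by (intro sum_mono mult_right_mono) auto
  finally have *: "2 * (\<Sum>i<n - m. (2 * K\<^sup>2 - e i * e (i + m)) * (v i * v (i + m)))
    \<le> (\<Sum>i<n. 2 * (2 * K\<^sup>2 - (e i)\<^sup>2) * (v i)\<^sup>2)" .
  have "(\<Sum>i<n - m. (2 * K\<^sup>2 - e i * e (i + m)) * (v i * v (i + m)))
      = 2 * K\<^sup>2 * lag_sum n m v - lag_sum n m (\<lambda>i. e i * v i)"
    unfolding lag_sum_def sum_distrib_left sum_subtractf[symmetric]
    by (intro sum.cong refl) (simp add: algebra_simps)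
  moreover have "(\<Sum>i<n. 2 * (2 * K\<^sup>2 - (e i)\<^sup>2) * (v i)\<^sup>2)
      = 2 * (2 * K\<^sup>2 * lag_sum n 0 v - lag_sum n 0 (\<lambda>i. e i * v i))"
    unfolding lag_sum_def sum_distrib_left sum_subtractf[symmetric]
    by (simp add: algebra_simps power2_eq_square)
  ultimately show ?thesis using * by (simp add: algebra_simps)
qed

lemma lag_sum_le:
  "lag_sum n m v \<le> lag_sum n 0 v"
  using lag_form_convex_multiplier[of n "\<lambda>_. 1" 1 v m] by simp

section \<open>The bilinear form of the Toeplitz matrix\<close>

definition wsgd_entry :: "real \<Rightarrow> nat \<Rightarrow> nat \<Rightarrow> real" where
  "wsgd_entry \<alpha> i j = (if j \<le> i + 1 then wsgd_w \<alpha> (i + 1 - j) else 0)"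

text \<open>The form takes sequences and not vectors, so that pointwise multipliers and index shifts are
  plain operations on functions.\<close>
definition wsgd_form :: "real \<Rightarrow> nat \<Rightarrow> (nat \<Rightarrow> real) \<Rightarrow> (nat \<Rightarrow> real) \<Rightarrow> real" where
  "wsgd_form \<alpha> n a b =
     (\<Sum>i<n. \<Sum>j<n. a i * wsgd_entry \<alpha> i j * b j)"

text \<open>Summation along the diagonals of the Toeplitz matrix.  The first superdiagonal, with weight
  \<open>w\<^sub>0\<close>, and the first subdiagonal, with weight \<open>w\<^sub>2\<close>, contribute the same lag.\<close>
lemma wsgd_form_diag_lag_sum:
  "wsgd_form \<alpha> n v v
    = (wsgd_w \<alpha> 0 + wsgd_w \<alpha> 2) * lag_sum n 1 v + wsgd_w \<alpha> 1 * lag_sum n 0 v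
      + (\<Sum>k<n. wsgd_w \<alpha> (k + 3) * lag_sum n (k + 2) v)"
proof -
  let ?S = "\<lambda>k. \<Sum>i<n. \<Sum>j<n. if i + 1 = j + k then v i * v j else 0"
  have S_Suc: "?S (Suc k) = lag_sum n k v" for k
  proof -
    have "?S (Suc k) = (\<Sum>(i, j)\<in>{(i, j). i < n \<and> j < n \<and> i = j + k}. v i * v j)"
      unfolding sum.cartesian_product by (intro sum.mono_neutral_cong_right) (auto split: if_splits)
    also have "\<dots> = lag_sum n k v" unfolding lag_sum_def
      by (rule sum.reindex_bij_witness[of _ "\<lambda>j. (j + k, j)" snd]) auto
    finally show ?thesis .
  qed
  have S_0: "?S 0 = lag_sum n 1 v"
  proof -
    have "?S 0 = (\<Sum>(i, j)\<in>{(i, j). i < n \<and> j < n \<and> j = i + 1}. v i * v j)"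
      unfolding sum.cartesian_product by (intro sum.mono_neutral_cong_right) (auto split: if_splits)
    also have "\<dots> = lag_sum n 1 v" unfolding lag_sum_def
      by (rule sum.reindex_bij_witness[of _ "\<lambda>i. (i, i + 1)" fst]) auto
    finally show ?thesis .
  qed
  have entry: "wsgd_entry \<alpha> i j
      = (\<Sum>k<n + 3. if i + 1 = j + k then wsgd_w \<alpha> k else 0)" if "i < n" for i j
  proof (cases "j \<le> i + 1")
    case True
    then have "i + 1 = j + k \<longleftrightarrow> k = i + 1 - j" for k by auto
    then have "(\<Sum>k<n + 3. if i + 1 = j + k then wsgd_w \<alpha> k else 0)
        = (\<Sum>k<n + 3. if k = i + 1 - j then wsgd_w \<alpha> k else 0)" by simp
    also have "\<dots> = wsgd_w \<alpha> (i + 1 - j)" using that by (subst sum.delta) auto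
    finally show ?thesis using True by (simp add: wsgd_entry_def)
  qed (auto simp: wsgd_entry_def)
  have "wsgd_form \<alpha> n v v
      = (\<Sum>i<n. \<Sum>j<n. \<Sum>k<n + 3. wsgd_w \<alpha> k * (if i + 1 = j + k then v i * v j else 0))"
    unfolding wsgd_form_def
    by (intro sum.cong refl, subst entry)
       (auto simp: sum_distrib_left sum_distrib_right intro!: sum.cong)
  also have "\<dots> = (\<Sum>i<n. \<Sum>k<n + 3. \<Sum>j<n. wsgd_w \<alpha> k * (if i + 1 = j + k then v i * v j else 0))"
    by (intro sum.cong refl sum.swap)
  also have "\<dots> = (\<Sum>k<n + 3. \<Sum>i<n. \<Sum>j<n. wsgd_w \<alpha> k * (if i + 1 = j + k then v i * v j else 0))"
    by (rule sum.swap)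
  also have "\<dots> = (\<Sum>k<n + 3. wsgd_w \<alpha> k * ?S k)"
    by (simp only: sum_distrib_left)
  also have "\<dots> = wsgd_w \<alpha> 0 * ?S 0 + wsgd_w \<alpha> 1 * ?S (Suc 0) + wsgd_w \<alpha> 2 * ?S (Suc 1)
      + (\<Sum>k<n. wsgd_w \<alpha> (k + 3) * ?S (Suc (k + 2)))"
  proof -
    have "(\<Sum>k<n + 3. F k) = F 0 + F (Suc 0) + F (Suc 1) + (\<Sum>k<n. F (k + 3))" for F :: "nat \<Rightarrow> real"
      by (induction n) (auto simp: numeral_3_eq_3)
    from this[of "\<lambda>k. wsgd_w \<alpha> k * ?S k"] show ?thesis
      by (simp only: numeral_3_eq_3 numeral_2_eq_2 add_Suc_right add_0_right One_nat_def)
  qed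
  also have "\<dots> = wsgd_w \<alpha> 0 * lag_sum n 1 v + wsgd_w \<alpha> 1 * lag_sum n 0 v + wsgd_w \<alpha> 2 * lag_sum n 1 v
      + (\<Sum>k<n. wsgd_w \<alpha> (k + 3) * lag_sum n (k + 2) v)"
    by (simp only: S_Suc S_0)
  finally show ?thesis by (simp add: algebra_simps)
qed

text \<open>For \<open>1 < \<alpha> < 2\<close> all coefficients on the right are nonnegative, which reduces statements about
  the energy to statements about one lag.  The sum at lag \<open>n\<close> is empty, so the remainder of the
  diagonal also takes the form of a difference of lags.\<close>
lemma minus_wsgd_form_diag_eq:
  "- wsgd_form \<alpha> n v v
    = (wsgd_w \<alpha> 0 + wsgd_w \<alpha> 2) * (lag_sum n 0 v - lag_sum n 1 v)
      + (\<Sum>k<n. wsgd_w \<alpha> (k + 3) * (lag_sum n 0 v - lag_sum n (k + 2) v))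
      + - (\<Sum>k\<le>n + 2. wsgd_w \<alpha> k) * (lag_sum n 0 v - lag_sum n n v)"
proof -
  have "(\<Sum>k\<le>n + 2. wsgd_w \<alpha> k)
      = wsgd_w \<alpha> 0 + wsgd_w \<alpha> 1 + wsgd_w \<alpha> 2 + (\<Sum>k<n. wsgd_w \<alpha> (k + 3))"
    by (induction n) (auto simp: numeral_3_eq_3 numeral_2_eq_2 simp del: wsgd_w.simps)
  moreover have "lag_sum n n v = 0" by (simp add: lag_sum_def)
  ultimately show ?thesis
    unfolding wsgd_form_diag_lag_sum
    by (simp add: algebra_simps sum_subtractf sum_distrib_right sum_distrib_left del: wsgd_w.simps)
qed

lemma wsgd_form_diag_nonpos:
  assumes "1 < \<alpha>" "\<alpha> < 2"
  shows "wsgd_form \<alpha> n v v \<le> 0"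
proof -
  have lag: "lag_sum n 0 v - lag_sum n m v \<ge> 0" for m
    using lag_sum_le[of n m v] by simp
  have "0 \<le> (wsgd_w \<alpha> 0 + wsgd_w \<alpha> 2) * (lag_sum n 0 v - lag_sum n 1 v)"
    using wsgd_w_0_2_pos[OF assms(1)] lag[of 1] by (intro mult_nonneg_nonneg) linarith+
  moreover have "0 \<le> (\<Sum>k<n. wsgd_w \<alpha> (k + 3) * (lag_sum n 0 v - lag_sum n (k + 2) v))"
    using wsgd_w_nonneg[OF assms] lag by (intro sum_nonneg mult_nonneg_nonneg)
  moreover have "0 \<le> - (\<Sum>k\<le>n + 2. wsgd_w \<alpha> k) * (lag_sum n 0 v - lag_sum n n v)"
    using sum_wsgd_w_nonpos[OF assms, of n] lag[of n] by (intro mult_nonneg_nonneg) linarith+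
  ultimately have "- wsgd_form \<alpha> n v v \<ge> 0"
    unfolding minus_wsgd_form_diag_eq by linarith
  then show ?thesis by simp
qed

lemma wsgd_form_diag_convex_multiplier:
  assumes \<alpha>: "1 < \<alpha>" "\<alpha> < 2"
    and K: "\<And>i. i < n \<Longrightarrow> 0 \<le> e i \<and> e i \<le> K"
    and conv: "\<And>i k. k \<le> i \<Longrightarrow> i + k < n \<Longrightarrow> 2 * e i \<le> e (i - k) + e (i + k)"
  shows "- wsgd_form \<alpha> n (\<lambda>i. e i * v i) (\<lambda>i. e i * v i) \<le> 2 * K\<^sup>2 * - wsgd_form \<alpha> n v v"
proof -
  let ?P = "\<lambda>m v. lag_sum n 0 v - lag_sum n m v"
  have mono: "c * ?P m (\<lambda>i. e i * v i) \<le> 2 * K\<^sup>2 * (c * ?P m v)" if "c \<ge> 0" for c m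
    using mult_left_mono[OF lag_form_convex_multiplier[OF K conv, where v = v and m = m] that]
    by (simp only: mult.left_commute mult.assoc)
  show ?thesis
    unfolding minus_wsgd_form_diag_eq distrib_left[of "2 * K\<^sup>2"] sum_distrib_left
    using wsgd_w_0_2_pos[OF \<alpha>(1)] wsgd_w_nonneg[OF \<alpha>] sum_wsgd_w_nonpos[OF \<alpha>, of n]
    by (intro add_mono sum_mono mono) (auto simp del: wsgd_w.simps)
qed

section \<open>The generating function and its sector\<close>

lemma summable_gen_g:
  assumes "1 < \<alpha>" "\<alpha> < 2"
  shows "summable (\<lambda>k. complex_of_real (wsgd_w \<alpha> k) * exp (\<i> * complex_of_real ((real k - 1) * x)))"
  using summable_norm_wsgd_w[OF assms] by - (rule summable_norm_cancel, simp add: norm_mult del: wsgd_w.simps)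

text \<open>As the weights have nonpositive sum, \<open>- Re g(x)\<close> is at least the sum of
  \<open>w\<^sub>k (1 - cos ((k - 1) x))\<close>.  The only weights that may be negative are \<open>w\<^sub>1\<close>, which meets the zero
  frequency, and \<open>w\<^sub>2\<close>, which meets the same frequency as \<open>w\<^sub>0\<close> and is outweighed by it.\<close>
lemma Re_gen_g_neg:
  assumes \<alpha>: "1 < \<alpha>" "\<alpha> < 2" and x: "cos x < 1"
  shows "Re (gen_g \<alpha> x) < 0"
proof -
  let ?d = "\<lambda>k. wsgd_w \<alpha> k * (1 - cos ((real k - 1) * x))"
  have w: "summable (wsgd_w \<alpha>)"
    using summable_norm_wsgd_w[OF \<alpha>] by - (rule summable_norm_cancel, simp)
  have c: "(\<lambda>k. wsgd_w \<alpha> k * cos ((real k - 1) * x)) sums Re (gen_g \<alpha> x)"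
    using sums_Re[OF summable_sums[OF summable_gen_g[OF \<alpha>, of x]]]
    by (simp add: gen_g_def exp_eq_polar del: wsgd_w.simps)
  have d: "?d sums (suminf (wsgd_w \<alpha>) - Re (gen_g \<alpha> x))"
    using sums_diff[OF summable_sums[OF w] c] by (simp add: algebra_simps)
  have "(\<Sum>k<3. ?d k) \<le> suminf ?d"
  proof (rule sum_le_suminf)
    fix k :: nat assume "k \<in> - {..<3}"
    then have "wsgd_w \<alpha> k \<ge> 0" using wsgd_w_nonneg[OF \<alpha>, of "k - 3"] by simp
    then show "0 \<le> ?d k" by (intro mult_nonneg_nonneg) auto
  qed (use d sums_summable in auto)
  moreover have "(\<Sum>k<3. ?d k) = (wsgd_w \<alpha> 0 + wsgd_w \<alpha> 2) * (1 - cos x)"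
    by (simp add: numeral_3_eq_3 algebra_simps numeral_2_eq_2 del: wsgd_w.simps)
  moreover have "\<dots> > 0" using wsgd_w_0_2_pos[OF \<alpha>(1)] x by (intro mult_pos_pos) auto
  moreover have "suminf (wsgd_w \<alpha>) \<le> 0"
  proof (rule LIMSEQ_le_const2)
    show "(\<lambda>n. \<Sum>k\<le>n. wsgd_w \<alpha> k) \<longlonglongrightarrow> suminf (wsgd_w \<alpha>)"
      using w by (simp add: summable_LIMSEQ')
    show "\<exists>N. \<forall>n\<ge>N. (\<Sum>k\<le>n. wsgd_w \<alpha> k) \<le> 0"
    proof (intro exI allI impI)
      fix n :: nat assume "2 \<le> n"
      then have "n - 2 + 2 = n" by simp
      then show "(\<Sum>k\<le>n. wsgd_w \<alpha> k) \<le> 0" using sum_wsgd_w_nonpos[OF \<alpha>, of "n - 2"] by (simp only:)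
    qed
  qed
  moreover have "suminf ?d = suminf (wsgd_w \<alpha>) - Re (gen_g \<alpha> x)" using d by (simp add: sums_iff)
  ultimately show ?thesis by linarith
qed

lemma grunwald_g_eq_gbinomial:
  "complex_of_real (grunwald_g \<alpha> k) = (- 1) ^ k * (complex_of_real \<alpha> gchoose k)"
proof (induction k)
  case (Suc k)
  have "of_nat (Suc k) * (complex_of_real \<alpha> gchoose Suc k) = (complex_of_real \<alpha> - of_nat k) * (complex_of_real \<alpha> gchoose k)"
    by (simp only: gbinomial_absorption gbinomial_absorb_comp)
  then have "complex_of_real \<alpha> gchoose Suc k
      = (complex_of_real \<alpha> - of_nat k) / of_nat (Suc k) * (complex_of_real \<alpha> gchoose k)"
    by (metis (no_types, lifting) nonzero_mult_div_cancel_left of_nat_neq_0 times_divide_eq_left)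
  moreover have "complex_of_real (1 - (\<alpha> + 1) / real (Suc k)) = - ((complex_of_real \<alpha> - of_nat k) / of_nat (Suc k))"
    by (simp add: field_simps del: of_nat_Suc) (simp add: algebra_simps)
  ultimately show ?case using Suc.IH by simp
qed simp

lemma grunwald_g_powser_interior:
  assumes "norm z < 1"
  shows "(\<Sum>k. complex_of_real (grunwald_g \<alpha> k) * z ^ k) = (1 - z) powr complex_of_real \<alpha>"
proof -
  have "(\<lambda>k. (complex_of_real \<alpha> gchoose k) * (- z) ^ k) sums (1 + - z) powr complex_of_real \<alpha>"
    using assms by (intro gen_binomial_complex) simp
  moreover have "(complex_of_real \<alpha> gchoose k) * (- z) ^ k = complex_of_real (grunwald_g \<alpha> k) * z ^ k" for k
    by (simp add: grunwald_g_eq_gbinomial power_minus[of z])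
  ultimately show ?thesis by (simp add: sums_iff)
qed

text \<open>The binomial series extends from the open disc to its boundary along the radius: absolute
  summability of the coefficients makes the series continuous up to the circle, and away from the
  point 1 the number \<open>1 - t cis x\<close> stays in the right half plane, where the power is continuous.\<close>
lemma grunwald_g_powser_circle:
  assumes \<alpha>: "1 < \<alpha>" "\<alpha> < 2" and x: "cos x < 1"
  shows "(\<Sum>k. complex_of_real (grunwald_g \<alpha> k) * cis x ^ k) = (1 - cis x) powr complex_of_real \<alpha>"
proof -
  let ?G = "\<lambda>t. \<Sum>k. complex_of_real (grunwald_g \<alpha> k) * (complex_of_real t * cis x) ^ k"
  let ?H = "\<lambda>t. (1 - complex_of_real t * cis x) powr complex_of_real \<alpha>"
  have "continuous_on {0..1} ?G"
  proof (rule uniform_limit_theorem)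
    show "uniform_limit {0..1} (\<lambda>n t. \<Sum>k<n. complex_of_real (grunwald_g \<alpha> k) * (complex_of_real t * cis x) ^ k) ?G sequentially"
    proof (rule Weierstrass_m_test)
      fix k :: nat and t :: real assume "t \<in> {0..1}"
      then show "norm (complex_of_real (grunwald_g \<alpha> k) * (complex_of_real t * cis x) ^ k) \<le> \<bar>grunwald_g \<alpha> k\<bar>"
        by (auto simp: norm_mult norm_power intro!: mult_left_le power_le_one simp del: grunwald_g.simps)
    qed (rule summable_norm_grunwald_g[OF \<alpha>])
  qed (auto intro!: always_eventually continuous_intros)
  moreover have "continuous_on {0..1} ?H"
  proof -
    have pos: "Re (1 - complex_of_real t * cis x) > 0" if "t \<in> {0..1}" for t
    proof (cases "cos x \<le> 0")
      case True then show ?thesis using that mult_nonneg_nonpos[of t "cos x"] by simp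
    next
      case False
      then have "t * cos x \<le> 1 * cos x" using that by (intro mult_right_mono) auto
      then show ?thesis using x by simp
    qed
    show ?thesis
    proof (intro continuous_on_powr_complex continuous_intros)
      show "{0..1} \<subseteq> {t. 0 \<le> Re (1 - complex_of_real t * cis x) \<or> Im (1 - complex_of_real t * cis x) \<noteq> 0}"
        using less_imp_le[OF pos] by blast
    qed (use \<alpha> in auto)
  qed
  ultimately have "continuous_on (closure {0..<1}) (\<lambda>t. ?G t - ?H t)"
    by (simp add: continuous_on_diff)
  moreover have "?G t - ?H t = 0" if "t \<in> {0..<1}" for t
    using that grunwald_g_powser_interior[of "complex_of_real t * cis x" \<alpha>] by (simp add: norm_mult)
  ultimately have "?G 1 - ?H 1 = 0"
    by (rule continuous_constant_on_closure) auto
  then show ?thesis by simp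
qed

text \<open>The polar form of \<open>1 - cis x\<close> has argument \<open>(x - pi) / 2\<close>, in the range of the principal
  logarithm.\<close>
lemma one_minus_cis_powr:
  assumes "0 < x" "x \<le> pi"
  shows "(1 - cis x) powr complex_of_real \<alpha>
    = complex_of_real ((2 * sin (x / 2)) powr \<alpha>) * cis (\<alpha> * (x - pi) / 2)"
proof -
  have s: "sin (x / 2) > 0" using assms by (intro sin_gt_zero) auto
  let ?L = "complex_of_real (ln (2 * sin (x / 2))) + \<i> * complex_of_real ((x - pi) / 2)"
  have "exp ?L = complex_of_real (2 * sin (x / 2)) * cis (x / 2 - pi / 2)"
    using s by (simp add: exp_add cis_conv_exp exp_of_real diff_divide_distrib)
  also have "\<dots> = 1 - cis x"
    using sin_double[of "x / 2"] cos_double_sin[of "x / 2"]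
    by (simp add: complex_eq_iff cos_diff sin_diff power2_eq_square)
  finally have E: "1 - cis x = exp ?L" by simp
  then have "Ln (1 - cis x) = ?L" using assms by (simp add: Ln_exp)
  then have "(1 - cis x) powr complex_of_real \<alpha> = exp (complex_of_real \<alpha> * ?L)"
    using E by (simp add: powr_def)
  also have "\<dots> = exp (complex_of_real (\<alpha> * ln (2 * sin (x / 2)))) * exp (\<i> * complex_of_real (\<alpha> * (x - pi) / 2))"
    by (simp add: exp_add[symmetric] algebra_simps)
  finally show ?thesis using s by (simp only: exp_of_real) (simp add: powr_def cis_conv_exp)
qed

lemma gen_g_closed_form:
  assumes \<alpha>: "1 < \<alpha>" "\<alpha> < 2" and x: "0 < x" "x \<le> pi"
  shows "gen_g \<alpha> x = complex_of_real ((2 * sin (x / 2)) powr \<alpha>)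
     * (complex_of_real (\<alpha> / 2) * cis (- x) + complex_of_real (1 - \<alpha> / 2)) * cis (\<alpha> * (x - pi) / 2)"
proof -
  let ?g = "\<lambda>k. complex_of_real (grunwald_g \<alpha> k) * cis x ^ k"
  let ?w = "\<lambda>k. complex_of_real (wsgd_w \<alpha> k) * exp (\<i> * complex_of_real ((real k - 1) * x))"
  have c: "cos x < 1" using x cos_monotone_0_pi[of 0 x] by simp
  have sg: "summable ?g"
    using summable_norm_grunwald_g[OF \<alpha>] by - (rule summable_norm_cancel, simp add: norm_mult norm_power del: grunwald_g.simps)
  have z: "exp (\<i> * complex_of_real ((real k - 1) * x)) = cis (- x) * cis x ^ k" for k
    by (simp add: cis_conv_exp exp_add[symmetric] exp_of_nat_mult[symmetric] algebra_simps)
  have zz: "cis (- x) * cis x = 1" by (simp add: cis_mult)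
  have "(\<lambda>k. cis (- x) * complex_of_real (\<alpha> / 2) * ?g (Suc k) + complex_of_real (1 - \<alpha> / 2) * ?g k) sums
     (cis (- x) * complex_of_real (\<alpha> / 2) * (suminf ?g - ?g 0) + complex_of_real (1 - \<alpha> / 2) * suminf ?g)"
    using sums_Suc_iff[of ?g "suminf ?g - ?g 0"] summable_sums[OF sg]
    by (intro sums_add sums_mult) (simp_all del: grunwald_g.simps power_Suc)
  moreover have "cis (- x) * complex_of_real (\<alpha> / 2) * ?g (Suc k) + complex_of_real (1 - \<alpha> / 2) * ?g k = ?w (Suc k)" for k
  proof -
    have "cis (- x) * cis x ^ Suc k = cis x ^ k" using zz by (simp add: mult.assoc[symmetric])
    then show ?thesis unfolding z
      by (simp add: field_simps del: grunwald_g.simps power_Suc)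
  qed
  ultimately have "?w sums (cis (- x) * complex_of_real (\<alpha> / 2) * (suminf ?g - ?g 0) + complex_of_real (1 - \<alpha> / 2) * suminf ?g + ?w 0)"
    by (subst sums_Suc_iff[symmetric]) simp
  moreover have "?w 0 = cis (- x) * complex_of_real (\<alpha> / 2)" unfolding z by simp
  ultimately have "?w sums ((cis (- x) * complex_of_real (\<alpha> / 2) + complex_of_real (1 - \<alpha> / 2)) * suminf ?g)"
    by (simp only:) (simp add: algebra_simps)
  then have "gen_g \<alpha> x = (cis (- x) * complex_of_real (\<alpha> / 2) + complex_of_real (1 - \<alpha> / 2)) * suminf ?g"
    unfolding gen_g_def by (rule sums_unique[symmetric])
  then show ?thesis
    unfolding grunwald_g_powser_circle[OF \<alpha> c] one_minus_cis_powr[OF x] by (simp add: algebra_simps)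
qed

lemma gen_g_uminus:
  assumes "1 < \<alpha>" "\<alpha> < 2"
  shows "gen_g \<alpha> (- x) = cnj (gen_g \<alpha> x)"
proof -
  have "(\<lambda>k. cnj (complex_of_real (wsgd_w \<alpha> k) * exp (\<i> * complex_of_real ((real k - 1) * x)))) sums cnj (gen_g \<alpha> x)"
    unfolding sums_cnj gen_g_def by (intro summable_sums summable_gen_g assms)
  moreover have "cnj (complex_of_real (wsgd_w \<alpha> k) * exp (\<i> * complex_of_real ((real k - 1) * x)))
     = complex_of_real (wsgd_w \<alpha> k) * exp (\<i> * complex_of_real ((real k - 1) * - x))" for k
    by (simp add: exp_cnj del: wsgd_w.simps)
  ultimately have "(\<lambda>k. complex_of_real (wsgd_w \<alpha> k) * exp (\<i> * complex_of_real ((real k - 1) * - x))) sums cnj (gen_g \<alpha> x)"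
    by (simp only:)
  then show ?thesis unfolding gen_g_def[of \<alpha> "- x"] by (rule sums_unique[symmetric])
qed

text \<open>After division by \<open>(2 sin (x / 2))\<^sup>\<alpha>\<close>, the function \<open>- Re g\<close> becomes continuous on all of \<open>[0, pi]\<close>.
  It is positive there, at \<open>0\<close> because its value is \<open>- cos (\<alpha> pi / 2)\<close>, and hence it has a positive
  minimum.  That minimum bounds the quotient because \<open>|g|\<close> divided by the same factor is at most 1.\<close>
lemma sector_constant_exists:
  assumes \<alpha>: "1 < \<alpha>" "\<alpha> < 2"
  obtains c where "c > 0" "\<And>x. x \<in> {-pi..pi} - {0} \<Longrightarrow> c \<le> Re (- gen_g \<alpha> x) / cmod (gen_g \<alpha> x)"
proof -
  let ?F = "\<lambda>x. - Re ((complex_of_real (\<alpha> / 2) * cis (- x) + complex_of_real (1 - \<alpha> / 2)) * cis (\<alpha> * (x - pi) / 2))"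
  have "continuous_on {0..pi} ?F" by (intro continuous_intros) auto
  then obtain x0 where x0: "x0 \<in> {0..pi}" and min: "\<And>y. y \<in> {0..pi} \<Longrightarrow> ?F x0 \<le> ?F y"
    using continuous_attains_inf[of "{0..pi}" ?F] by auto
  have gF: "Re (- gen_g \<alpha> x) = (2 * sin (x / 2)) powr \<alpha> * ?F x" if "0 < x" "x \<le> pi" for x
    unfolding gen_g_closed_form[OF \<alpha> that] by (simp add: algebra_simps)
  have neg: "Re (gen_g \<alpha> x) < 0" if "0 < x" "x \<le> pi" for x
    using that cos_monotone_0_pi[of 0 x] by (intro Re_gen_g_neg[OF \<alpha>]) simp
  have F_pos: "?F x > 0" if "x \<in> {0..pi}" for x
  proof (cases "x = 0")
    case True
    have "cos (\<alpha> * pi / 2) < 0"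
      using \<alpha> cos_monotone_0_pi[of "pi / 2" "\<alpha> * pi / 2"] by simp
    then show ?thesis using True by (simp add: algebra_simps)
  next
    case False
    then have "0 < (2 * sin (x / 2)) powr \<alpha> * ?F x" using that neg[of x] gF[of x] by auto
    then show ?thesis by (simp add: zero_less_mult_iff)
  qed
  have pos: "?F x0 \<le> Re (- gen_g \<alpha> x) / cmod (gen_g \<alpha> x)" if x: "0 < x" "x \<le> pi" for x
  proof -
    have "cmod (complex_of_real (\<alpha> / 2) * cis (- x) + complex_of_real (1 - \<alpha> / 2)) \<le> \<alpha> / 2 + (1 - \<alpha> / 2)"
      using \<alpha> by (intro norm_triangle_mono) (simp_all add: norm_mult del: of_real_diff of_real_divide)
    then have "cmod (gen_g \<alpha> x) \<le> (2 * sin (x / 2)) powr \<alpha>"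
      unfolding gen_g_closed_form[OF \<alpha> x] norm_mult norm_cis by (simp add: mult_left_le)
    then have "?F x * cmod (gen_g \<alpha> x) \<le> Re (- gen_g \<alpha> x)"
      unfolding gF[OF x] using F_pos[of x] x by (subst mult.commute, intro mult_right_mono) auto
    moreover have "cmod (gen_g \<alpha> x) > 0" using neg[OF x] by force
    ultimately have "?F x \<le> Re (- gen_g \<alpha> x) / cmod (gen_g \<alpha> x)" by (simp only: pos_le_divide_eq)
    then show ?thesis using min[of x] x by simp
  qed
  show ?thesis
  proof (rule that)
    show "?F x0 > 0" by (rule F_pos[OF x0])
    fix x :: real assume x: "x \<in> {-pi..pi} - {0}"
    show "?F x0 \<le> Re (- gen_g \<alpha> x) / cmod (gen_g \<alpha> x)"
    proof (cases "0 < x")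
      case True then show ?thesis using pos[of x] x by auto
    next
      case False then show ?thesis using pos[of "- x"] x by (auto simp: gen_g_uminus[OF \<alpha>])
    qed
  qed
qed

lemma varsigma_pos:
  assumes "1 < \<alpha>" "\<alpha> < 2"
  shows "varsigma \<alpha> > 0"
proof -
  obtain c where c: "c > 0" "\<And>x. x \<in> {-pi..pi} - {0} \<Longrightarrow> c \<le> Re (- gen_g \<alpha> x) / cmod (gen_g \<alpha> x)"
    using sector_constant_exists[OF assms] by blast
  have "pi \<in> {-pi..pi} - {0}" using pi_gt_zero by simp
  then have "c \<le> varsigma \<alpha>" unfolding varsigma_def using c(2) by (intro cINF_greatest) blast+
  then show ?thesis using c by simp
qed

lemma varsigma_sector:
  assumes \<alpha>: "1 < \<alpha>" "\<alpha> < 2" and x: "x \<in> {-pi..pi}" "x \<noteq> 0"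
  shows "varsigma \<alpha> * cmod (gen_g \<alpha> x) \<le> Re (- gen_g \<alpha> x)"
proof -
  obtain c where c: "c > 0" "\<And>x. x \<in> {-pi..pi} - {0} \<Longrightarrow> c \<le> Re (- gen_g \<alpha> x) / cmod (gen_g \<alpha> x)"
    using sector_constant_exists[OF \<alpha>] by blast
  have "varsigma \<alpha> \<le> Re (- gen_g \<alpha> x) / cmod (gen_g \<alpha> x)"
    unfolding varsigma_def using x c(2) by (intro cINF_lower bdd_belowI2[of _ c]) auto
  moreover have "cmod (gen_g \<alpha> x) > 0"
    using c(1) c(2)[of x] x by (cases "gen_g \<alpha> x = 0") auto
  ultimately show ?thesis by (simp only: pos_le_divide_eq)
qed

section \<open>The sector bound for the bilinear form\<close>

lemma has_integral_cis_int:
  "((\<lambda>x. cis (of_int m * x)) has_integral (if m = 0 then 2 * complex_of_real pi else 0)) {-pi..pi}"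
proof (cases "m = 0")
  case True
  then show ?thesis using has_integral_const_real[of "1::complex" "-pi" pi] by (simp add: scaleR_conv_of_real)
next
  case False
  let ?F = "\<lambda>x. cis (of_int m * x) / (\<i> * of_int m)"
  have "((\<lambda>x. cis (of_int m * x)) has_integral (?F pi - ?F (- pi))) {-pi..pi}"
  proof (rule fundamental_theorem_of_calculus)
    fix x :: real
    have "((\<lambda>z. exp (c * z) / c) has_field_derivative exp (c * complex_of_real x)) (at (complex_of_real x))"
      if "c \<noteq> 0" for c
      using that by (auto intro!: derivative_eq_intros)
    from has_vector_derivative_real_field[OF this[of "\<i> * of_int m"]] False
    show "(?F has_vector_derivative cis (of_int m * x)) (at x within {-pi..pi})"
      by (simp add: cis_conv_exp mult.assoc)
  qed auto
  moreover have "?F pi = ?F (- pi)"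
  proof -
    have "sin (of_int m * pi) = 0" by (auto simp: sin_zero_iff_int2)
    then show ?thesis by (simp add: cis.ctr)
  qed
  ultimately show ?thesis using False by simp
qed

text \<open>The matrix entries are the Fourier coefficients of the generating function.  The series may be
  integrated term by term because it converges uniformly.\<close>
lemma gen_g_fourier_coefficient:
  assumes \<alpha>: "1 < \<alpha>" "\<alpha> < 2"
  shows "((\<lambda>x. gen_g \<alpha> x * cis ((real j - real i) * x)) has_integral
     2 * complex_of_real pi * complex_of_real (wsgd_entry \<alpha> i j)) {-pi..pi}"
proof -
  let ?f = "\<lambda>k x. complex_of_real (wsgd_w \<alpha> k) * exp (\<i> * complex_of_real ((real k - 1) * x)) * cis ((real j - real i) * x)"
  let ?c = "wsgd_entry \<alpha> i j"
  let ?I = "\<lambda>N. \<Sum>k<N. complex_of_real (wsgd_w \<alpha> k) * (if int k - 1 + int j - int i = 0 then 2 * complex_of_real pi else 0)"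
  have f_cis: "?f k x = complex_of_real (wsgd_w \<alpha> k) * cis (of_int (int k - 1 + int j - int i) * x)" for k x
    by (simp add: cis_conv_exp exp_add[symmetric] algebra_simps del: wsgd_w.simps)
  have sum_int: "((\<lambda>x. \<Sum>k<N. ?f k x) has_integral ?I N) {-pi..pi}" for N
    unfolding f_cis by (intro has_integral_sum finite_lessThan has_integral_mult_right has_integral_cis_int)
  have "uniform_limit {-pi..pi} (\<lambda>N x. \<Sum>k<N. ?f k x) (\<lambda>x. \<Sum>k. ?f k x) sequentially"
    by (rule Weierstrass_m_test[OF _ summable_norm_wsgd_w[OF \<alpha>]]) (simp add: norm_mult del: wsgd_w.simps)
  moreover have "(\<Sum>k. ?f k x) = gen_g \<alpha> x * cis ((real j - real i) * x)" for x
    unfolding gen_g_def by (rule suminf_mult2[OF summable_gen_g[OF \<alpha>], symmetric])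
  ultimately have lim: "uniform_limit {-pi..pi} (\<lambda>N x. \<Sum>k<N. ?f k x)
      (\<lambda>x. gen_g \<alpha> x * cis ((real j - real i) * x)) sequentially" by simp
  obtain I J where I: "\<And>N. ((\<lambda>x. \<Sum>k<N. ?f k x) has_integral I N) {-pi..pi}"
    and J: "((\<lambda>x. gen_g \<alpha> x * cis ((real j - real i) * x)) has_integral J) {-pi..pi}" and IJ: "I \<longlonglongrightarrow> J"
    by (rule uniform_limit_integral[OF lim]) (auto intro!: continuous_intros)
  \<comment> \<open>Only the weight with index \<open>i + 1 - j\<close> survives integration, and \<open>N \<ge> i + 2\<close> terms contain it.\<close>
  have "?I N = 2 * complex_of_real pi * complex_of_real ?c" if "N \<ge> i + 2" for N
  proof (cases "j \<le> i + 1")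
    case True
    then have "int k - 1 + int j - int i = 0 \<longleftrightarrow> k = i + 1 - j" for k by auto
    then have "?I N = (\<Sum>k<N. if k = i + 1 - j then complex_of_real (wsgd_w \<alpha> k) * (2 * complex_of_real pi) else 0)"
      by (intro sum.cong) (auto simp del: wsgd_w.simps)
    then show ?thesis using True that by (simp add: sum.delta wsgd_entry_def del: wsgd_w.simps)
  next
    case False
    then have "int k - 1 + int j - int i \<noteq> 0" for k by auto
    then show ?thesis using False by (simp add: wsgd_entry_def)
  qed
  then have "\<forall>\<^sub>F N in sequentially. I N = 2 * complex_of_real pi * complex_of_real ?c"
    using has_integral_unique[OF I sum_int]
    by (intro eventually_mono[OF eventually_ge_at_top[of "i + 2"]]) (simp only:)
  then have "J = 2 * complex_of_real pi * complex_of_real ?c"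
    using IJ by (metis tendsto_eventually LIMSEQ_unique)
  then show ?thesis using J by simp
qed

definition trig_poly :: "nat \<Rightarrow> (nat \<Rightarrow> real) \<Rightarrow> real \<Rightarrow> complex" where
  "trig_poly n a x = (\<Sum>j<n. complex_of_real (a j) * cis (real j * x))"

lemma has_integral_wsgd_form:
  assumes \<alpha>: "1 < \<alpha>" "\<alpha> < 2"
  shows "((\<lambda>x. Re (gen_g \<alpha> x * cnj (trig_poly n a x) * trig_poly n b x)) has_integral
    2 * pi * wsgd_form \<alpha> n a b) {-pi..pi}"
proof -
  have "((\<lambda>x. \<Sum>i<n. \<Sum>j<n. complex_of_real (a i * b j) * (gen_g \<alpha> x * cis ((real j - real i) * x))) has_integral
    (\<Sum>i<n. \<Sum>j<n. complex_of_real (a i * b j) * (2 * complex_of_real pi * complex_of_real (wsgd_entry \<alpha> i j)))) {-pi..pi}"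
    by (intro has_integral_sum finite_lessThan has_integral_mult_right gen_g_fourier_coefficient \<alpha>)
  moreover have "(\<Sum>i<n. \<Sum>j<n. complex_of_real (a i * b j) * (gen_g \<alpha> x * cis ((real j - real i) * x)))
      = gen_g \<alpha> x * cnj (trig_poly n a x) * trig_poly n b x" for x
  proof -
    have "cis ((real j - real i) * x) = cis (- (real i * x)) * cis (real j * x)" for i j :: nat
      by (simp add: cis_mult algebra_simps)
    then show ?thesis
      by (simp add: trig_poly_def sum_distrib_left sum_distrib_right cis_cnj mult_ac)
  qed
  moreover have "(\<Sum>i<n. \<Sum>j<n. complex_of_real (a i * b j) * (2 * complex_of_real pi * complex_of_real (wsgd_entry \<alpha> i j)))
      = complex_of_real (2 * pi * wsgd_form \<alpha> n a b)"
    unfolding wsgd_form_def sum_distrib_left of_real_sum by (intro sum.cong refl) (simp add: mult_ac)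
  ultimately have "((\<lambda>x. gen_g \<alpha> x * cnj (trig_poly n a x) * trig_poly n b x) has_integral
      complex_of_real (2 * pi * wsgd_form \<alpha> n a b)) {-pi..pi}" by simp
  from has_integral_linear[OF this bounded_linear_Re] show ?thesis by (simp add: o_def)
qed

text \<open>With \<open>p\<close> and \<open>q\<close> the trigonometric polynomials of \<open>a\<close> and \<open>b\<close>, the integrands satisfy
  \<open>2 \<varsigma> |g| |p| |q| \<le> Re (-g) (t |p|\<^sup>2 + |q|\<^sup>2 / t)\<close> pointwise.  The free parameter \<open>t\<close> takes the place of the
  Cauchy-Schwarz inequality for the energy.\<close>
lemma wsgd_form_sector_bound:
  assumes \<alpha>: "1 < \<alpha>" "\<alpha> < 2" and t: "t > 0"
  shows "2 * varsigma \<alpha> * wsgd_form \<alpha> n a b \<le> t * - wsgd_form \<alpha> n a a + - wsgd_form \<alpha> n b b / t"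
proof -
  let ?h = "\<lambda>a b x. Re (gen_g \<alpha> x * cnj (trig_poly n a x) * trig_poly n b x)"
  let ?D = "\<lambda>x. - t * ?h a a x + - (1 / t) * ?h b b x - 2 * varsigma \<alpha> * ?h a b x"
  have int: "(?D has_integral (- t * (2 * pi * wsgd_form \<alpha> n a a) + - (1 / t) * (2 * pi * wsgd_form \<alpha> n b b)
     - 2 * varsigma \<alpha> * (2 * pi * wsgd_form \<alpha> n a b))) {-pi..pi}"
    by (intro has_integral_diff has_integral_add has_integral_mult_right has_integral_wsgd_form \<alpha>)
  have nonneg: "0 \<le> ?D x" if x: "x \<in> {-pi..pi} - {0}" for x
  proof -
    let ?p = "cmod (trig_poly n a x)" and ?q = "cmod (trig_poly n b x)"
    have diag: "?h v v x = - (Re (- gen_g \<alpha> x) * (cmod (trig_poly n v x))\<^sup>2)" for v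
    proof -
      have "gen_g \<alpha> x * cnj (trig_poly n v x) * trig_poly n v x
          = gen_g \<alpha> x * complex_of_real ((cmod (trig_poly n v x))\<^sup>2)"
        by (simp only: complex_norm_square mult_ac)
      then show ?thesis by (simp only:) simp
    qed
    have young: "2 * (?p * ?q) \<le> t * ?p\<^sup>2 + ?q\<^sup>2 / t"
    proof -
      have "0 \<le> (t * ?p - ?q)\<^sup>2 / t" using t by simp
      then show ?thesis using t by (simp add: power2_eq_square field_simps)
    qed
    have "?h a b x \<le> cmod (gen_g \<alpha> x * cnj (trig_poly n a x) * trig_poly n b x)" by (rule complex_Re_le_cmod)
    also have "\<dots> = cmod (gen_g \<alpha> x) * (?p * ?q)" by (simp add: norm_mult)
    finally have "2 * varsigma \<alpha> * ?h a b x \<le> 2 * varsigma \<alpha> * (cmod (gen_g \<alpha> x) * (?p * ?q))"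
      using varsigma_pos[OF \<alpha>] by (intro mult_left_mono) auto
    also have "\<dots> = varsigma \<alpha> * cmod (gen_g \<alpha> x) * (2 * (?p * ?q))" by simp
    also have "\<dots> \<le> varsigma \<alpha> * cmod (gen_g \<alpha> x) * (t * ?p\<^sup>2 + ?q\<^sup>2 / t)"
      using varsigma_pos[OF \<alpha>] by (intro mult_left_mono young) auto
    also have "\<dots> \<le> Re (- gen_g \<alpha> x) * (t * ?p\<^sup>2 + ?q\<^sup>2 / t)"
      using varsigma_sector[OF \<alpha>, of x] x t by (intro mult_right_mono) auto
    also have "\<dots> = - t * ?h a a x + - (1 / t) * ?h b b x"
      unfolding diag using t by (simp add: field_simps)
    finally show ?thesis by simp
  qed
  \<comment> \<open>The infimum that defines \<open>\<varsigma>\<close> leaves out \<open>x = 0\<close>, so the integrand is changed there.\<close>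
  have "((\<lambda>x. if x = 0 then 0 else ?D x) has_integral (- t * (2 * pi * wsgd_form \<alpha> n a a)
     + - (1 / t) * (2 * pi * wsgd_form \<alpha> n b b) - 2 * varsigma \<alpha> * (2 * pi * wsgd_form \<alpha> n a b))) {-pi..pi}"
    by (rule has_integral_spike_finite[OF _ _ int, of "{0}"]) auto
  then have "0 \<le> - t * (2 * pi * wsgd_form \<alpha> n a a) + - (1 / t) * (2 * pi * wsgd_form \<alpha> n b b)
     - 2 * varsigma \<alpha> * (2 * pi * wsgd_form \<alpha> n a b)"
    by (rule has_integral_nonneg) (use nonneg in auto)
  then have "(2 * pi) * (2 * varsigma \<alpha> * wsgd_form \<alpha> n a b)
      \<le> (2 * pi) * (t * - wsgd_form \<alpha> n a a + - wsgd_form \<alpha> n b b / t)"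
    by (simp add: algebra_simps)
  then show ?thesis by (rule mult_left_le_imp_le) simp
qed

section \<open>Dissipativity of the two-sided operator\<close>

text \<open>Multiplication by \<open>e\<close> enlarges the energy by at most \<open>(\<surd>2 K)\<^sup>2\<close>, so \<open>t = \<surd>2 K\<close> balances the two
  terms of the sector bound.  The sign \<open>s\<close> covers upper and lower estimates at once.\<close>
lemma wsgd_form_convex_multiplier_bound:
  assumes \<alpha>: "1 < \<alpha>" "\<alpha> < 2"
    and K: "\<And>i. i < n \<Longrightarrow> 0 \<le> e i \<and> e i \<le> K"
    and conv: "\<And>i k. k \<le> i \<Longrightarrow> i + k < n \<Longrightarrow> 2 * e i \<le> e (i - k) + e (i + k)"
    and s: "s\<^sup>2 = 1"
  shows "s * wsgd_form \<alpha> n v (\<lambda>i. e i * v i) \<le> sqrt 2 * K / varsigma \<alpha> * - wsgd_form \<alpha> n v v"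
proof (cases "n = 0 \<or> K = 0")
  case True
  then have "e i = 0" if "i < n" for i using K[OF that] that by auto
  then have "wsgd_form \<alpha> n v (\<lambda>i. e i * v i) = 0"
    by (simp add: wsgd_form_def)
  then show ?thesis using True by (auto simp: wsgd_form_def)
next
  case False
  then have Kpos: "K > 0" using K[of 0] by auto
  let ?b = "\<lambda>i. s * (e i * v i)" and ?c = "sqrt 2 * K" and ?E = "- wsgd_form \<alpha> n v v"
  have "wsgd_form \<alpha> n ?b ?b = s\<^sup>2 * wsgd_form \<alpha> n (\<lambda>i. e i * v i) (\<lambda>i. e i * v i)"
    by (simp add: wsgd_form_def sum_distrib_left power2_eq_square mult_ac)
  then have Eb: "- wsgd_form \<alpha> n ?b ?b \<le> ?c\<^sup>2 * ?E"
    using wsgd_form_diag_convex_multiplier[OF \<alpha> K conv, where v = v] s by (simp add: power_mult_distrib)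
  have c: "?c > 0" using Kpos by simp
  have "2 * varsigma \<alpha> * wsgd_form \<alpha> n v ?b \<le> ?c * ?E + - wsgd_form \<alpha> n ?b ?b / ?c"
    by (rule wsgd_form_sector_bound[OF \<alpha> c])
  also have "\<dots> \<le> ?c * ?E + ?c\<^sup>2 * ?E / ?c"
    using Eb c by (intro add_left_mono divide_right_mono) auto
  also have "\<dots> = 2 * (?c * ?E)" using c by (simp add: power2_eq_square)
  finally have "varsigma \<alpha> * wsgd_form \<alpha> n v ?b \<le> ?c * ?E" by linarith
  moreover have "wsgd_form \<alpha> n v ?b = s * wsgd_form \<alpha> n v (\<lambda>i. e i * v i)"
    by (simp add: wsgd_form_def sum_distrib_left mult_ac)
  ultimately show ?thesis
    using varsigma_pos[OF \<alpha>] by (simp add: field_simps)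
qed

text \<open>Here \<open>v\<^sup>T(W + DW\<^sup>T)v\<close> appears as \<open>v\<^sup>TWv + v\<^sup>TW(Dv)\<close>, the transposed half being rewritten by
  symmetry of the scalar product.  The diagonal \<open>d\<close> splits as \<open>\<kappa> + s e\<close> with \<open>e = s (d - \<kappa>)\<close> convex:
  \<open>s = 1\<close> serves convex \<open>d\<close> with \<open>\<kappa>\<close> its lower bound, and \<open>s = -1\<close> serves concave \<open>d\<close> with \<open>\<kappa>\<close> its upper
  bound.\<close>
lemma wsgd_form_two_sided_nonpos:
  fixes d :: "nat \<Rightarrow> real"
  assumes \<alpha>: "1 < \<alpha>" "\<alpha> < 2"
    and s: "s\<^sup>2 = 1"
    and e: "\<And>i. i < n \<Longrightarrow> 0 \<le> s * (d i - \<kappa>) \<and> s * (d i - \<kappa>) \<le> K"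
    and conv: "\<And>i k. k \<le> i \<Longrightarrow> i + k < n \<Longrightarrow>
      2 * (s * (d i - \<kappa>)) \<le> s * (d (i - k) - \<kappa>) + s * (d (i + k) - \<kappa>)"
    and cond: "0 \<le> 1 + \<kappa> - sqrt 2 * K / varsigma \<alpha>"
  shows "wsgd_form \<alpha> n v v + wsgd_form \<alpha> n v (\<lambda>i. d i * v i) \<le> 0"
proof -
  have "wsgd_form \<alpha> n v (\<lambda>i. d i * v i)
      = \<kappa> * wsgd_form \<alpha> n v v + s * wsgd_form \<alpha> n v (\<lambda>i. s * (d i - \<kappa>) * v i)"
  proof -
    have "s * (s * (d i - \<kappa>) * v i) = s\<^sup>2 * ((d i - \<kappa>) * v i)" for i
      by (simp add: power2_eq_square)
    then have "d i * v i = \<kappa> * v i + s * (s * (d i - \<kappa>) * v i)" for i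
      using s by (simp add: algebra_simps)
    then have "wsgd_form \<alpha> n v (\<lambda>i. d i * v i) = wsgd_form \<alpha> n v (\<lambda>i. \<kappa> * v i + s * (s * (d i - \<kappa>) * v i))" by simp
    also have "\<dots> = \<kappa> * wsgd_form \<alpha> n v v + s * wsgd_form \<alpha> n v (\<lambda>i. s * (d i - \<kappa>) * v i)"
      unfolding wsgd_form_def sum_distrib_left sum.distrib[symmetric]
      by (intro sum.cong refl) (simp add: algebra_simps del: wsgd_w.simps)
    finally show ?thesis .
  qed
  moreover have "s * wsgd_form \<alpha> n v (\<lambda>i. s * (d i - \<kappa>) * v i) \<le> sqrt 2 * K / varsigma \<alpha> * - wsgd_form \<alpha> n v v"
    by (rule wsgd_form_convex_multiplier_bound[OF \<alpha> e conv s])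
  moreover have "0 \<le> (1 + \<kappa> - sqrt 2 * K / varsigma \<alpha>) * - wsgd_form \<alpha> n v v"
    using cond wsgd_form_diag_nonpos[OF \<alpha>, of n v] by (intro mult_nonneg_nonneg) auto
  ultimately show ?thesis by (simp add: algebra_simps)
qed

section \<open>The scheme in coordinates\<close>

lemma grid_x_in_interval:
  assumes "xL < xR" "M \<ge> 1" "i \<le> M"
  shows "grid_x xL xR M i \<in> {xL..xR}"
proof -
  have h: "0 \<le> mesh_h xL xR M" "real M * mesh_h xL xR M = xR - xL"
    using assms by (simp_all add: mesh_h_def)
  have "real i * mesh_h xL xR M \<le> real M * mesh_h xL xR M" using assms h(1) by (intro mult_right_mono) auto
  then show ?thesis using h by (simp add: grid_x_def)
qed

lemma convex_on_grid:
  assumes "convex_on {xL..xR} d" "xL < xR" "M \<ge> 1" "k \<le> i" "i + k \<le> M"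
  shows "2 * d (grid_x xL xR M i) \<le> d (grid_x xL xR M (i - k)) + d (grid_x xL xR M (i + k))"
proof -
  let ?x = "grid_x xL xR M"
  have "?x i = (1 - 1 / 2) *\<^sub>R ?x (i - k) + (1 / 2) *\<^sub>R ?x (i + k)"
    using assms(4) by (simp add: grid_x_def of_nat_diff field_simps)
  then have "d (?x i) \<le> (1 - 1 / 2) * d (?x (i - k)) + 1 / 2 * d (?x (i + k))"
    using convex_onD[OF assms(1), of "1 / 2" "?x (i - k)" "?x (i + k)"] assms
      grid_x_in_interval[OF assms(2,3)] by simp
  then show ?thesis by simp
qed

lemma index_scheme_A:
  assumes "i < M - 1" "j < M - 1"
  shows "scheme_A xL xR M \<alpha> dp dm $$ (i, j)
    = dp (grid_x xL xR M (i + 1)) * wsgd_entry \<alpha> i j + dm (grid_x xL xR M (i + 1)) * wsgd_entry \<alpha> j i"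
proof -
  have W: "wsgd_W \<alpha> M \<in> carrier_mat (M - 1) (M - 1)" by (simp add: wsgd_W_def)
  then have Wt: "transpose_mat (wsgd_W \<alpha> M) \<in> carrier_mat (M - 1) (M - 1)" by simp
  have entry: "wsgd_W \<alpha> M $$ (i, j) = wsgd_entry \<alpha> i j" if "i < M - 1" "j < M - 1" for i j
    using that by (simp add: wsgd_W_def wsgd_entry_def del: wsgd_w.simps)
  show ?thesis
    unfolding scheme_A_def diag_D_def mat_diag_mult_left[OF W] mat_diag_mult_left[OF Wt]
    using assms W by (simp add: entry)
qed

lemma scheme_A_carrier: "scheme_A xL xR M \<alpha> dp dm \<in> carrier_mat (M - 1) (M - 1)"
  unfolding scheme_A_def diag_D_def wsgd_W_def
  by (intro add_carrier_mat mult_carrier_mat[of _ _ "M - 1"] mat_diag_dim) auto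

lemma smult_mat_mult_vec:
  fixes A :: "'a :: semiring_0 mat"
  assumes "A \<in> carrier_mat nr nc" "v \<in> carrier_vec nc"
  shows "(c \<cdot>\<^sub>m A) *\<^sub>v v = c \<cdot>\<^sub>v (A *\<^sub>v v)"
  using assms by (intro eq_vecI) (auto simp: scalar_prod_def sum_distrib_left mult.assoc intro!: sum.cong)

lemma wnorm2_Dhat:
  assumes "v \<in> carrier_vec (M - 1)" "\<And>i. i < M - 1 \<Longrightarrow> dp (grid_x xL xR M (i + 1)) \<noteq> 0"
  shows "wnorm2 h (Dhat xL xR M dp) v = h * (\<Sum>i<M - 1. (v $ i)\<^sup>2 / dp (grid_x xL xR M (i + 1)))"
proof -
  have D: "Dhat xL xR M dp = diag_D xL xR M (\<lambda>x. 1 / dp x)" using assms(2) by (rule Dhat_eq)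
  have "(Dhat xL xR M dp *\<^sub>v v) $ i = v $ i / dp (grid_x xL xR M (i + 1))" if "i < M - 1" for i
  proof -
    have "(Dhat xL xR M dp *\<^sub>v v) $ i
      = (\<Sum>j = 0..<M - 1. (if i = j then 1 / dp (grid_x xL xR M (j + 1)) else 0) * v $ j)"
      unfolding D using assms(1) that by (auto simp: diag_D_def mat_diag_def scalar_prod_def intro!: sum.cong)
    also have "\<dots> = (\<Sum>j = 0..<M - 1. if i = j then v $ j / dp (grid_x xL xR M (j + 1)) else 0)"
      by (intro sum.cong) auto
    also have "\<dots> = v $ i / dp (grid_x xL xR M (i + 1))" using that by (subst sum.delta') auto
    finally show ?thesis .
  qed
  moreover have "dim_vec (Dhat xL xR M dp *\<^sub>v v) = M - 1"
    unfolding D by (simp add: diag_D_def mat_diag_def)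
  ultimately show ?thesis
    by (simp add: wnorm2_def scalar_prod_def lessThan_atLeast0 power2_eq_square)
qed

section \<open>One time step and growth in time\<close>

text \<open>The Cauchy-Schwarz inequality for the scalar product with weights \<open>1 / p\<close>.\<close>
lemma weighted_sum_mult_le:
  fixes p x y :: "nat \<Rightarrow> real"
  assumes "\<And>i. i < n \<Longrightarrow> p i > 0"
  shows "(\<Sum>i<n. x i * y i / p i) \<le> sqrt (\<Sum>i<n. (x i)\<^sup>2 / p i) * sqrt (\<Sum>i<n. (y i)\<^sup>2 / p i)"
proof -
  have "(\<Sum>i<n. x i * y i / p i) \<le> (\<Sum>i<n. \<bar>x i / sqrt (p i)\<bar> * \<bar>y i / sqrt (p i)\<bar>)"
  proof (rule sum_mono)
    fix i assume "i \<in> {..<n}"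
    then have "p i = sqrt (p i) * sqrt (p i)" using assms[of i] by simp
    then have "x i * y i / p i = (x i / sqrt (p i)) * (y i / sqrt (p i))" by (metis times_divide_times_eq)
    then show "x i * y i / p i \<le> \<bar>x i / sqrt (p i)\<bar> * \<bar>y i / sqrt (p i)\<bar>"
      by (metis abs_ge_self abs_mult)
  qed
  also have "\<dots> \<le> L2_set (\<lambda>i. x i / sqrt (p i)) {..<n} * L2_set (\<lambda>i. y i / sqrt (p i)) {..<n}"
    by (rule L2_set_mult_ineq)
  also have "\<dots> = sqrt (\<Sum>i<n. (x i)\<^sup>2 / p i) * sqrt (\<Sum>i<n. (y i)\<^sup>2 / p i)"
    unfolding L2_set_def using assms by (simp add: power_divide less_imp_le)
  finally show ?thesis .
qed

lemma le_add_of_square_diff_le: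
  fixes a b q :: real
  assumes "0 \<le> a" "0 \<le> b" "0 \<le> q" "a\<^sup>2 - b\<^sup>2 \<le> q * (a + b)"
  shows "a \<le> b + q"
proof (rule ccontr)
  assume "\<not> a \<le> b + q"
  then have "a - b > q" "a + b > 0" using assms by auto
  then have "q * (a + b) < (a - b) * (a + b)" by (rule mult_strict_right_mono)
  then show False using assms(4) by (simp add: power2_eq_square algebra_simps)
qed

text \<open>Each row is multiplied by \<open>(a\<^sub>i + b\<^sub>i) / p\<^sub>i\<close>.  The left side becomes the difference of the squared
  norms, the matrix part drops out by its sign, and the Cauchy-Schwarz inequality leaves
  \<open>|a|\<^sup>2 - |b|\<^sup>2 \<le> \<tau> |g| (|a| + |b|)\<close>, from which the factor \<open>|a| + |b|\<close> cancels.\<close>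
lemma scheme_step_bound:
  fixes p d a b g :: "nat \<Rightarrow> real"
  assumes p: "\<And>i. i < n \<Longrightarrow> p i > 0" and \<nu>: "0 \<le> \<nu>" and \<tau>: "0 \<le> \<tau>"
    and dissip: "\<And>v. wsgd_form \<alpha> n v v + wsgd_form \<alpha> n v (\<lambda>i. d i * v i) \<le> 0"
    and step: "\<And>i. i < n \<Longrightarrow> a i - b i = \<nu> * p i *
       (\<Sum>j<n. (wsgd_entry \<alpha> i j + d i * wsgd_entry \<alpha> j i) * (a j + b j)) + \<tau> * g i"
  shows "sqrt (\<Sum>i<n. (a i)\<^sup>2 / p i) \<le> sqrt (\<Sum>i<n. (b i)\<^sup>2 / p i) + \<tau> * sqrt (\<Sum>i<n. (g i)\<^sup>2 / p i)"
proof -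
  let ?N = "\<lambda>v. sqrt (\<Sum>i<n. (v i)\<^sup>2 / p i)" and ?s = "\<lambda>i. a i + b i"
  have sum_nonneg': "0 \<le> (\<Sum>i<n. (v i)\<^sup>2 / p i)" for v
    using p by (intro sum_nonneg) (auto simp: less_imp_le)
  have form: "(\<Sum>i<n. ?s i * (\<Sum>j<n. (wsgd_entry \<alpha> i j + d i * wsgd_entry \<alpha> j i) * ?s j))
     = wsgd_form \<alpha> n ?s ?s + wsgd_form \<alpha> n ?s (\<lambda>i. d i * ?s i)"
  proof -
    have "wsgd_form \<alpha> n ?s (\<lambda>i. d i * ?s i) = (\<Sum>i<n. \<Sum>j<n. ?s j * wsgd_entry \<alpha> j i * (d i * ?s i))"
      unfolding wsgd_form_def by (rule sum.swap)
    then show ?thesis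
      unfolding wsgd_form_def sum_distrib_left
      by (simp add: sum.distrib[symmetric] algebra_simps)
  qed
  have "(?N a)\<^sup>2 - (?N b)\<^sup>2 = (\<Sum>i<n. ?s i * (a i - b i) / p i)"
    unfolding real_sqrt_pow2[OF sum_nonneg'] sum_subtractf[symmetric]
    by (simp add: diff_divide_distrib[symmetric] power2_eq_square algebra_simps)
  also have "\<dots> = (\<Sum>i<n. \<nu> * (?s i * (\<Sum>j<n. (wsgd_entry \<alpha> i j + d i * wsgd_entry \<alpha> j i) * ?s j))
      + \<tau> * (g i * a i / p i + g i * b i / p i))"
  proof (intro sum.cong refl)
    fix i assume i: "i \<in> {..<n}"
    let ?S = "\<Sum>j<n. (wsgd_entry \<alpha> i j + d i * wsgd_entry \<alpha> j i) * ?s j"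
    have "?s i * (a i - b i) / p i = ?s i * (\<nu> * p i * ?S + \<tau> * g i) / p i"
      using step[of i] i by simp
    also have "\<dots> = \<nu> * (?s i * ?S) + \<tau> * (g i * a i / p i + g i * b i / p i)"
      using p[of i] i by (simp add: field_simps)
    finally show "?s i * (a i - b i) / p i = \<nu> * (?s i * ?S) + \<tau> * (g i * a i / p i + g i * b i / p i)" .
  qed
  also have "\<dots> = \<nu> * (wsgd_form \<alpha> n ?s ?s + wsgd_form \<alpha> n ?s (\<lambda>i. d i * ?s i))
      + \<tau> * ((\<Sum>i<n. g i * a i / p i) + (\<Sum>i<n. g i * b i / p i))"
    unfolding form[symmetric] by (simp add: sum.distrib sum_distrib_left[symmetric])
  also have "\<dots> \<le> 0 + \<tau> * (?N g * ?N a + ?N g * ?N b)"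
    using \<nu> \<tau> dissip[of ?s]
    by (intro add_mono mult_left_mono mult_nonneg_nonpos weighted_sum_mult_le p)
  finally have "(?N a)\<^sup>2 - (?N b)\<^sup>2 \<le> \<tau> * ?N g * (?N a + ?N b)" by (simp add: algebra_simps)
  then show ?thesis
    using \<tau> sum_nonneg' by (intro le_add_of_square_diff_le mult_nonneg_nonneg real_sqrt_ge_zero)
qed

text \<open>The Cauchy-Schwarz inequality for the pairs \<open>(1, \<surd>T)\<close> and \<open>(a, \<surd>T F)\<close>, with the factor \<open>1 + T\<close>
  then absorbed into the exponential.\<close>
lemma square_growth_bound:
  fixes T :: real
  assumes "0 \<le> T"
  shows "(a + T * F)\<^sup>2 \<le> exp (2 * T) * (a\<^sup>2 + 2 * T * F\<^sup>2)"
proof -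
  have "(1 + T) * (a\<^sup>2 + T * F\<^sup>2) - (a + T * F)\<^sup>2 = T * (a - F)\<^sup>2"
    by (simp add: power2_eq_square algebra_simps)
  moreover have "T * (a - F)\<^sup>2 \<ge> 0" using assms by simp
  ultimately have *: "(a + T * F)\<^sup>2 \<le> (1 + T) * (a\<^sup>2 + T * F\<^sup>2)" by linarith
  have "1 + T \<le> exp (2 * T)" using assms exp_ge_add_one_self[of "2 * T"] by linarith
  then have "(1 + T) * (a\<^sup>2 + T * F\<^sup>2) \<le> exp (2 * T) * (a\<^sup>2 + 2 * T * F\<^sup>2)"
    using assms by (intro mult_mono add_left_mono mult_right_mono) auto
  with * show ?thesis by (rule order.trans)
qed

theorem theorem3p8:
  fixes \<alpha> xL xR T \<kappa> \<kappa>min \<kappa>max :: real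
    and M N :: nat
    and dp dm \<phi> :: "real \<Rightarrow> real"
    and f :: "real \<Rightarrow> real \<Rightarrow> real"
    and u :: "nat \<Rightarrow> real vec"
  assumes "1 < \<alpha>" and "\<alpha> < 2"
    and "xL < xR" and "T > 0" and "M \<ge> 1" and "N \<ge> 1"
    and "\<And>x. x \<in> {xL..xR} \<Longrightarrow> dp x > 0"
    and "\<And>x. x \<in> {xL..xR} \<Longrightarrow> dm x \<ge> 0"
    and "0 \<le> \<kappa>min"
    and "\<And>x. x \<in> {xL..xR} \<Longrightarrow> \<kappa>min \<le> dm x / dp x \<and> dm x / dp x \<le> \<kappa>max"
    and "(concave_on {xL..xR} (\<lambda>x. dm x / dp x) \<and> \<kappa> = \<kappa>max) \<or>
         (convex_on {xL..xR} (\<lambda>x. dm x / dp x) \<and> \<kappa> = \<kappa>min)"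
    and "1 + \<kappa> - sqrt 2 * (\<kappa>max - \<kappa>min) / varsigma \<alpha> \<ge> 0"
    and "solves_scheme xL xR M T N \<alpha> dp dm f \<phi> u"
  shows "\<forall>n<N.
    wnorm2 (mesh_h xL xR M) (Dhat xL xR M dp) (u (n + 1)) \<le>
      exp (2 * T) *
        (wnorm2 (mesh_h xL xR M) (Dhat xL xR M dp) (grid_vec xL xR M \<phi>) +
         2 * T * (MAX k\<in>{0..n}.
           wnorm2 (mesh_h xL xR M) (Dhat xL xR M dp) (source_vec xL xR M T N f k)))"
proof -
  let ?n = "M - 1" and ?h = "mesh_h xL xR M" and ?\<tau> = "mesh_tau T N"
  let ?\<nu> = "scheme_nu ?\<tau> ?h \<alpha>" and ?A = "scheme_A xL xR M \<alpha> dp dm"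
  let ?x = "\<lambda>i. grid_x xL xR M (i + 1)" and ?F = "source_vec xL xR M T N f"
  let ?norm2 = "wnorm2 ?h (Dhat xL xR M dp)"
  define p where "p i = dp (?x i)" for i
  define d where "d i = dm (?x i) / dp (?x i)" for i
  have x: "?x i \<in> {xL..xR}" if "i < ?n" for i
    using that assms(3,5) by (intro grid_x_in_interval) auto
  have p: "p i > 0" if "i < ?n" for i unfolding p_def using x[OF that] by (rule assms(7))
  have h: "?h \<ge> 0" using assms(3) by (simp add: mesh_h_def)
  have \<tau>: "?\<tau> \<ge> 0" using assms(4) by (simp add: mesh_tau_def)
  have \<nu>: "?\<nu> \<ge> 0" using \<tau> by (simp add: scheme_nu_def)
  have norm2: "?norm2 v = ?h * (\<Sum>i<?n. (v $ i)\<^sup>2 / p i)" if "v \<in> carrier_vec ?n" for v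
    unfolding p_def using p that by (intro wnorm2_Dhat) (force simp: p_def)+
  have norm2_nonneg: "0 \<le> ?norm2 v" if "v \<in> carrier_vec ?n" for v
    unfolding norm2[OF that] using h p by (intro mult_nonneg_nonneg sum_nonneg) (auto simp: less_imp_le)
  have F: "?F k \<in> carrier_vec ?n" for k by (simp add: source_vec_def grid_vec_def)

  have bounds: "\<kappa>min \<le> d i \<and> d i \<le> \<kappa>max" if "i < ?n" for i
    unfolding d_def using x[OF that] by (rule assms(10))
  have conv: "2 * r (?x i) \<le> r (?x (i - k)) + r (?x (i + k))"
    if "convex_on {xL..xR} r" "k \<le> i" "i + k < ?n" for r :: "real \<Rightarrow> real" and i k
    using convex_on_grid[OF that(1) assms(3,5), of k "i + 1"] that(2,3) by (simp add: Suc_diff_le)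
  have dissip: "wsgd_form \<alpha> ?n v v + wsgd_form \<alpha> ?n v (\<lambda>i. d i * v i) \<le> 0" for v
    using assms(11)
  proof
    assume concave: "concave_on {xL..xR} (\<lambda>x. dm x / dp x) \<and> \<kappa> = \<kappa>max"
    show ?thesis
    proof (rule wsgd_form_two_sided_nonpos[OF assms(1,2), where s = "-1" and \<kappa> = \<kappa> and K = "\<kappa>max - \<kappa>min"])
      show "0 \<le> - 1 * (d i - \<kappa>) \<and> - 1 * (d i - \<kappa>) \<le> \<kappa>max - \<kappa>min" if "i < ?n" for i
        using bounds[OF that] concave by auto
      show "2 * (- 1 * (d i - \<kappa>)) \<le> - 1 * (d (i - k) - \<kappa>) + - 1 * (d (i + k) - \<kappa>)"
        if "k \<le> i" "i + k < ?n" for i k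
        using conv[of "\<lambda>x. - (dm x / dp x)", OF _ that] concave by (simp add: concave_on_def d_def)
    qed (use assms(12) in auto)
  next
    assume convex: "convex_on {xL..xR} (\<lambda>x. dm x / dp x) \<and> \<kappa> = \<kappa>min"
    show ?thesis
    proof (rule wsgd_form_two_sided_nonpos[OF assms(1,2), where s = 1 and \<kappa> = \<kappa> and K = "\<kappa>max - \<kappa>min"])
      show "0 \<le> 1 * (d i - \<kappa>) \<and> 1 * (d i - \<kappa>) \<le> \<kappa>max - \<kappa>min" if "i < ?n" for i
        using bounds[OF that] convex by auto
      show "2 * (1 * (d i - \<kappa>)) \<le> 1 * (d (i - k) - \<kappa>) + 1 * (d (i + k) - \<kappa>)"
        if "k \<le> i" "i + k < ?n" for i k
        using conv[of "\<lambda>x. dm x / dp x", OF _ that] convex by (simp add: d_def)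
    qed (use assms(12) in auto)
  qed

  have u: "u k \<in> carrier_vec ?n" if "k \<le> N" for k
    using assms(13) that by (simp add: solves_scheme_def Let_def)
  have u0: "u 0 = grid_vec xL xR M \<phi>"
    using assms(13) by (simp add: solves_scheme_def Let_def)
  have step: "sqrt (?norm2 (u (k + 1))) \<le> sqrt (?norm2 (u k)) + ?\<tau> * sqrt (?norm2 (?F k))" if k: "k < N" for k
  proof -
    have uk: "u k \<in> carrier_vec ?n" "u (k + 1) \<in> carrier_vec ?n" using u[of k] u[of "k + 1"] k by simp_all
    have eq: "(1\<^sub>m ?n - ?\<nu> \<cdot>\<^sub>m ?A) *\<^sub>v u (k + 1) = (1\<^sub>m ?n + ?\<nu> \<cdot>\<^sub>m ?A) *\<^sub>v u k + ?\<tau> \<cdot>\<^sub>v ?F k"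
      using assms(13) k by (simp add: solves_scheme_def Let_def)
    have row: "u (k + 1) $ i - u k $ i = ?\<nu> * p i *
       (\<Sum>j<?n. (wsgd_entry \<alpha> i j + d i * wsgd_entry \<alpha> j i) * (u (k + 1) $ j + u k $ j)) + ?\<tau> * ?F k $ i"
      if i: "i < ?n" for i
    proof -
      have A: "?A \<in> carrier_mat ?n ?n" by (rule scheme_A_carrier)
      have Av: "(?A *\<^sub>v v) $ i = p i * (\<Sum>j<?n. (wsgd_entry \<alpha> i j + d i * wsgd_entry \<alpha> j i) * v $ j)"
        if v: "v \<in> carrier_vec ?n" for v
      proof -
        have "(?A *\<^sub>v v) $ i = (\<Sum>j<?n. ?A $$ (i, j) * v $ j)"
          using A v i by (auto simp: scalar_prod_def lessThan_atLeast0 intro!: sum.cong)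
        also have "\<dots> = (\<Sum>j<?n. p i * ((wsgd_entry \<alpha> i j + d i * wsgd_entry \<alpha> j i) * v $ j))"
          using i p[OF i] by (intro sum.cong refl) (auto simp: index_scheme_A p_def d_def field_simps)
        finally show ?thesis by (simp add: sum_distrib_left)
      qed
      have "(1\<^sub>m ?n - ?\<nu> \<cdot>\<^sub>m ?A) *\<^sub>v u (k + 1) = u (k + 1) - ?\<nu> \<cdot>\<^sub>v (?A *\<^sub>v u (k + 1))"
        using minus_mult_distrib_mat_vec[OF one_carrier_mat smult_carrier_mat[OF A] uk(2)]
          smult_mat_mult_vec[OF A uk(2)] uk(2) by simp
      moreover have "(1\<^sub>m ?n + ?\<nu> \<cdot>\<^sub>m ?A) *\<^sub>v u k = u k + ?\<nu> \<cdot>\<^sub>v (?A *\<^sub>v u k)"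
        using add_mult_distrib_mat_vec[OF one_carrier_mat smult_carrier_mat[OF A] uk(1)]
          smult_mat_mult_vec[OF A uk(1)] uk(1) by simp
      ultimately have "(u (k + 1) - ?\<nu> \<cdot>\<^sub>v (?A *\<^sub>v u (k + 1))) $ i
          = (u k + ?\<nu> \<cdot>\<^sub>v (?A *\<^sub>v u k) + ?\<tau> \<cdot>\<^sub>v ?F k) $ i"
        using eq by simp
      then have "u (k + 1) $ i - ?\<nu> * (?A *\<^sub>v u (k + 1)) $ i = u k $ i + ?\<nu> * (?A *\<^sub>v u k) $ i + ?\<tau> * ?F k $ i"
        using A uk F[of k] i by (simp del: index_mult_mat_vec)
      then show ?thesis
        unfolding Av[OF uk(1)] Av[OF uk(2)] by (simp add: algebra_simps sum.distrib)
    qed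
    have "sqrt ?h * sqrt (\<Sum>i<?n. (u (k + 1) $ i)\<^sup>2 / p i)
        \<le> sqrt ?h * (sqrt (\<Sum>i<?n. (u k $ i)\<^sup>2 / p i) + ?\<tau> * sqrt (\<Sum>i<?n. (?F k $ i)\<^sup>2 / p i))"
      using h by (intro mult_left_mono scheme_step_bound[OF p \<nu> \<tau> dissip row]) auto
    then show ?thesis
      unfolding norm2[OF uk(1)] norm2[OF uk(2)] norm2[OF F] real_sqrt_mult by (simp add: algebra_simps)
  qed

  show ?thesis
  proof (intro allI impI)
    fix n assume n: "n < N"
    define G where "G = (MAX k\<in>{0..n}. ?norm2 (?F k))"
    have G: "?norm2 (?F k) \<le> G" if "k \<le> n" for k
      unfolding G_def using that by (intro Max_ge) auto
    then have G0: "0 \<le> G" using norm2_nonneg[OF F[of 0]] by (meson le0 order.trans)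
    \<comment> \<open>Only sources up to time level \<open>n\<close> enter, so \<open>G\<close> bounds each of the first \<open>n + 1\<close> increments.\<close>
    have "sqrt (?norm2 (u m)) \<le> sqrt (?norm2 (u 0)) + real m * (?\<tau> * sqrt G)" if "m \<le> n + 1" for m
      using that
    proof (induction m)
      case (Suc m)
      then have "sqrt (?norm2 (u (m + 1))) \<le> sqrt (?norm2 (u m)) + ?\<tau> * sqrt (?norm2 (?F m))"
        using n by (intro step) auto
      also have "\<dots> \<le> sqrt (?norm2 (u 0)) + real m * (?\<tau> * sqrt G) + ?\<tau> * sqrt G"
        using Suc \<tau> G[of m] by (intro add_mono mult_left_mono real_sqrt_le_mono) auto
      finally show ?case by (simp add: algebra_simps)
    qed simp
    from this[of "n + 1"] have "sqrt (?norm2 (u (n + 1))) \<le> sqrt (?norm2 (u 0)) + real (n + 1) * ?\<tau> * sqrt G"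
      by (simp only: mult.assoc order.refl)
    also have "\<dots> \<le> sqrt (?norm2 (u 0)) + T * sqrt G"
    proof -
      have "real (n + 1) * ?\<tau> \<le> real N * ?\<tau>" using n \<tau> by (intro mult_right_mono) auto
      also have "\<dots> = T" using assms(6) by (simp add: mesh_tau_def)
      finally show ?thesis using G0 by (intro add_left_mono mult_right_mono) auto
    qed
    finally have "(sqrt (?norm2 (u (n + 1))))\<^sup>2 \<le> (sqrt (?norm2 (u 0)) + T * sqrt G)\<^sup>2"
      using norm2_nonneg[OF u] n by (intro power_mono) auto
    also have "\<dots> \<le> exp (2 * T) * ((sqrt (?norm2 (u 0)))\<^sup>2 + 2 * T * (sqrt G)\<^sup>2)"
      using assms(4) by (intro square_growth_bound) auto
    finally show "?norm2 (u (n + 1)) \<le> exp (2 * T) * (?norm2 (grid_vec xL xR M \<phi>) + 2 * T * (MAX k\<in>{0..n}. ?norm2 (?F k)))"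
      using norm2_nonneg[OF u[of 0]] norm2_nonneg[OF u[of "n + 1"]] n G0 by (simp add: u0 G_def)
  qed
qed

end
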